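(* Let $gl_n$ be the algebra of $n\times n$ matrices over a field $\mathcal K$ of characteristic $0$, with the usual associative multiplication $(a,b)\mapsto a\circ b$, regarded as a right-symmetric algebra. Then: (1) $gl_n$ as a right-symmetric algebra has nontrivial deformations. (2) Any right-symmetric local deformation (2-cocycle of the regular module) is equivalent to a 2-cocycle $\eta_X$ of the form $\eta_X(a,b)=(\mathrm{tr}\,b)[X,a]$ for some $X\in sl_n$. (3) Any local right-symmetric deformation can be prolongated. (4) Any formal right-symmetric deformation of $gl_n$ is equivalent to a deformation of the form $$\mu_t(a,b)=a\circ b+t\,(\mathrm{tr}\,b)[X,a],\qquad X\in sl_n.$$
   Context: A product $\circ$ is right-symmetric if $a\circ(b\circ c)-(a\circ b)\circ c=a\circ(c\circ b)-(a\circ c)\circ b$; $[a,b]=a\circ b-b\circ a$; $sl_n$ is the space of traceless matrices. For $A=gl_n$, a formal right-symmetric deformation is a right-symmetric multiplication $\mu_t=\mu_0+t\mu_1+t^2\mu_2+\cdots$ on $A\otimes\mathcal K((t))$, where $\mathcal K((t))$ is the fraction field of $\mathcal K[[t]]$, the $\mu_i:A\times A\to A$ are bilinear maps, and $\mu_0(a,b)=a\circ b$. Two deformations $\mu_t,\nu_t$ are equivalent if there is $g_t=g_0+tg_1+t^2g_2+\cdots$ with $g_0=\mathrm{id}$, $g_i:A\to A$ linear, and $g_t^{-1}(\mu_t(g_t(a),g_t(b)))=\nu_t(a,b)$ for all $a,b\in A$; a deformation is nontrivial if it is not equivalent to $\mu_0$. A local deformation is a right-symmetric 2-cocycle with coefficients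 in the regular module, i.e. a bilinear map $\psi:A\times A\to A$ with $$a\circ\psi(b,c)-a\circ\psi(c,b)-\psi(a\circ b,c)+\psi(a\circ c,b)+\psi(a,[b,c])-\psi(a,b)\circ c+\psi(a,c)\circ b=0;$$ it can be prolongated if there is a formal right-symmetric deformation $\mu_t$ with $\mu_1=\psi$. Two 2-cocycles are equivalent if they differ by a coboundary $d\omega(a,b)=a\circ\omega(b)-\omega(a\circ b)+\omega(a)\circ b$, $\omega:A\to A$ linear.
   Formalization: Part (1) is stated for n ≥ 2, since for n = 1 every deformation is trivial; in part (4) X is a traceless matrix over K[[t]] rather than over K, since for non-scalar X the deformation a∘b + t²(tr b)[X,a] is not equivalent to any with X over K. *)

theory Defs
  imports "HOL-Analysis.Analysis" "HOL-Computational_Algebra.Formal_Laurent_Series"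
begin

text \<open>
  The algebra \<open>gl\<^sub>n\<close> over a ring \<open>R\<close> is the type \<open>R^'n^'n\<close> with product \<open>**\<close>, where
  \<open>n = CARD('n)\<close>. The space \<open>gl\<^sub>n \<otimes> K((t))\<close> is identified with \<open>gl\<^sub>n(K((t)))\<close>, that is
  with matrices over the Laurent series field \<open>'a fls\<close>.
\<close>

definition right_symmetric :: "('v::minus \<Rightarrow> 'v \<Rightarrow> 'v) \<Rightarrow> bool" where
  "right_symmetric m \<longleftrightarrow>
     (\<forall>a b c. m a (m b c) - m (m a b) c = m a (m c b) - m (m a c) b)"

text \<open>In the library, \<open>*s\<close> scales vectors over \<open>'a\<close>; a matrix is a vector of vectors.\<close>

definition mscale :: "'a::semiring_1 \<Rightarrow> 'a^'n^'n \<Rightarrow> 'a^'n^'n" where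
  "mscale c A = map_matrix (\<lambda>x. c * x) A"

abbreviation mlinear :: "('a::field^'n^'n \<Rightarrow> 'a^'n^'n) \<Rightarrow> bool" where
  "mlinear \<equiv> Vector_Spaces.linear mscale mscale"

definition mbilinear :: "('a::field^'n^'n \<Rightarrow> 'a^'n^'n \<Rightarrow> 'a^'n^'n) \<Rightarrow> bool" where
  "mbilinear f \<longleftrightarrow> (\<forall>a. mlinear (f a)) \<and> (\<forall>b. mlinear (\<lambda>a. f a b))"

definition mcomm :: "'a::ring_1^'n^'n \<Rightarrow> 'a^'n^'n \<Rightarrow> 'a^'n^'n" where
  "mcomm a b = a ** b - b ** a"

definition sl :: "('a::ring_1^'n^'n) set" where
  "sl = {X. trace X = 0}"

definition coboundary ::
  "('a::field^'n^'n \<Rightarrow> 'a^'n^'n) \<Rightarrow> 'a^'n^'n \<Rightarrow> 'a^'n^'n \<Rightarrow> 'a^'n^'n" where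
  "coboundary \<omega> a b = a ** \<omega> b - \<omega> (a ** b) + \<omega> a ** b"

definition local_deformation :: "('a::field^'n^'n \<Rightarrow> 'a^'n^'n \<Rightarrow> 'a^'n^'n) \<Rightarrow> bool" where
  "local_deformation \<psi> \<longleftrightarrow> mbilinear \<psi> \<and>
     (\<forall>a b c. a ** \<psi> b c - a ** \<psi> c b - \<psi> (a ** b) c + \<psi> (a ** c) b
        + \<psi> a (mcomm b c) - \<psi> a b ** c + \<psi> a c ** b = 0)"

definition cocycle_equiv ::
  "('a::field^'n^'n \<Rightarrow> 'a^'n^'n \<Rightarrow> 'a^'n^'n) \<Rightarrow> ('a^'n^'n \<Rightarrow> 'a^'n^'n \<Rightarrow> 'a^'n^'n) \<Rightarrow> bool" where
  "cocycle_equiv \<phi> \<psi> \<longleftrightarrow>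
     (\<exists>\<omega>. mlinear \<omega> \<and> (\<forall>a b. \<phi> a b - \<psi> a b = coboundary \<omega> a b))"

definition eta :: "'a::field^'n^'n \<Rightarrow> 'a^'n^'n \<Rightarrow> 'a^'n^'n \<Rightarrow> 'a^'n^'n" where
  "eta X a b = mscale (trace b) (mcomm X a)"

text \<open>The inclusion \<open>a \<mapsto> a \<otimes> 1\<close>, and the sum \<open>f 0 + t f 1 + t\<^sup>2 f 2 + \<dots>\<close>.\<close>

definition mconst :: "'a::field^'n^'n \<Rightarrow> 'a fls^'n^'n" where
  "mconst a = map_matrix fls_const a"

definition mseries :: "(nat \<Rightarrow> 'a::field^'n^'n) \<Rightarrow> 'a fls^'n^'n" where
  "mseries f = (\<chi> i j. fps_to_fls (Abs_fps (\<lambda>m. f m $ i $ j)))"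

text \<open>
  \<open>M\<close> is the multiplication \<open>\<mu>\<^sub>t\<close> on all of \<open>gl\<^sub>n \<otimes> K((t))\<close> and \<open>\<mu> i\<close> is the coefficient
  \<open>\<mu>\<^sub>i\<close>; the expansion of \<open>\<mu>\<^sub>t\<close> in powers of \<open>t\<close> holds for arguments from \<open>gl\<^sub>n\<close> itself, and
  determines \<open>M\<close> by bilinearity over \<open>K((t))\<close>.
\<close>

definition has_expansion ::
  "('a::field fls^'n^'n \<Rightarrow> 'a fls^'n^'n \<Rightarrow> 'a fls^'n^'n) \<Rightarrow>
   (nat \<Rightarrow> 'a^'n^'n \<Rightarrow> 'a^'n^'n \<Rightarrow> 'a^'n^'n) \<Rightarrow> bool" where
  "has_expansion M \<mu> \<longleftrightarrow> (\<forall>i. mbilinear (\<mu> i)) \<and>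
     (\<forall>a b. M (mconst a) (mconst b) = mseries (\<lambda>i. \<mu> i a b))"

definition formal_deformation_with ::
  "('a::field fls^'n^'n \<Rightarrow> 'a fls^'n^'n \<Rightarrow> 'a fls^'n^'n) \<Rightarrow>
   (nat \<Rightarrow> 'a^'n^'n \<Rightarrow> 'a^'n^'n \<Rightarrow> 'a^'n^'n) \<Rightarrow> bool" where
  "formal_deformation_with M \<mu> \<longleftrightarrow>
     mbilinear M \<and> right_symmetric M \<and> has_expansion M \<mu> \<and> \<mu> 0 = (**)"

definition formal_deformation ::
  "('a::field fls^'n^'n \<Rightarrow> 'a fls^'n^'n \<Rightarrow> 'a fls^'n^'n) \<Rightarrow> bool" where
  "formal_deformation M \<longleftrightarrow> (\<exists>\<mu>. formal_deformation_with M \<mu>)"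

text \<open>
  \<open>G\<close> is \<open>g\<^sub>t\<close>, extended linearly over \<open>K((t))\<close>. Bijectivity of \<open>G\<close> is automatic from
  \<open>g 0 = id\<close>; it is listed because \<open>inv G\<close> occurs.
\<close>

definition deformation_equiv ::
  "('a::field fls^'n^'n \<Rightarrow> 'a fls^'n^'n \<Rightarrow> 'a fls^'n^'n) \<Rightarrow>
   ('a fls^'n^'n \<Rightarrow> 'a fls^'n^'n \<Rightarrow> 'a fls^'n^'n) \<Rightarrow> bool" where
  "deformation_equiv M N \<longleftrightarrow>
     (\<exists>G g. mlinear G \<and> bij G \<and> g 0 = id \<and> (\<forall>i::nat. mlinear (g i)) \<and>
        (\<forall>a. G (mconst a) = mseries (\<lambda>i. g i a)) \<and>
        (\<forall>a b. inv G (M (G (mconst a)) (G (mconst b))) = N (mconst a) (mconst b)))"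

definition nontrivial_deformation ::
  "('a::field fls^'n^'n \<Rightarrow> 'a fls^'n^'n \<Rightarrow> 'a fls^'n^'n) \<Rightarrow> bool" where
  "nontrivial_deformation M \<longleftrightarrow> formal_deformation M \<and> \<not> deformation_equiv M (**)"

definition prolongable :: "('a::field^'n^'n \<Rightarrow> 'a^'n^'n \<Rightarrow> 'a^'n^'n) \<Rightarrow> bool" where
  "prolongable \<psi> \<longleftrightarrow> (\<exists>M \<mu>. formal_deformation_with M \<mu> \<and> \<mu> 1 = \<psi>)"

text \<open>
  The multiplication \<open>\<mu>\<^sub>t(a,b) = a \<circ> b + t (tr b) [X,a]\<close>. Here \<open>X\<close> is a matrix over
  \<open>K[[t]]\<close> and not just over \<open>K\<close>: for \<open>n \<ge> 2\<close> and \<open>X\<close> over \<open>K\<close> not scalar,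
  \<open>a \<circ> b + t\<^sup>2 (tr b) [X,a]\<close> is a deformation that is not equivalent to
  \<open>a \<circ> b + t (tr b) [Y,a]\<close> for any \<open>Y\<close> over \<open>K\<close>.
\<close>

definition eta_deformation ::
  "'a::field fps^'n^'n \<Rightarrow> 'a fls^'n^'n \<Rightarrow> 'a fls^'n^'n \<Rightarrow> 'a fls^'n^'n" where
  "eta_deformation X a b = a ** b + mscale fls_X (eta (map_matrix fps_to_fls X) a b)"

end

theory Submission
  imports Defs
begin

text \<open>
  Everything reduces to two facts. First, \<open>m(a,b) = ab + t (tr b)[Z,a]\<close> is exactly
  right-symmetric for every matrix \<open>Z\<close>: its associator is symmetric in the last two arguments
  because \<open>[Z,_]\<close> is a derivation with values of trace zero (\<open>eta_associator\<close>). Secondly, every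
  2-cocycle is \<open>\<eta>\<^sub>X + d\<omega>\<close> (\<open>cocycle_classification\<close>). Thus each infinitesimal direction is
  realised by an honest deformation, and there are no obstructions.

  The classification of cocycles uses the Casimir element \<open>\<Sum> e\<^sub>p\<^sub>q \<otimes> e\<^sub>q\<^sub>p\<close> twice. The
  cocycle condition on \<open>\<psi>\<close> says that the Hochschild coboundary \<open>\<delta>\<psi>(a,b,c)\<close> is symmetric in
  \<open>b, c\<close>. Contracting \<open>\<delta>\<psi>\<close> in its first argument recovers \<open>\<psi>\<close> up to a coboundary, so \<open>\<psi>\<close> is
  cohomologous to a symmetric cocycle (\<open>cocycle_cohomologous_to_symmetric\<close>). Contracting the
  cocycle condition of a symmetric \<open>\<phi>\<close> in its third argument expresses \<open>\<phi>\<close> through a linear map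
  \<open>L\<close> with \<open>L(ab) = L(ba)\<close>, that is, through the trace and one matrix \<open>X\<close>
  (\<open>symmetric_cocycle_form\<close>).

  For a prolongation of \<open>\<eta>\<^sub>X + d\<omega>\<close>, transport \<open>ab + t (tr b)[X,a]\<close> along \<open>id + t \<omega>\<close>. For the
  normal form of a deformation \<open>M\<close>, one looks for \<open>G = id + O(t)\<close> and \<open>X\<close> over \<open>K[[t]]\<close> such that
  the defect \<open>M(Ga,Gb) - G(ab + t (tr b)[X,a])\<close> vanishes. Its lowest coefficient is always a
  cocycle (\<open>leading_error_is_cocycle\<close>), and the next coefficients of \<open>G\<close> and \<open>X\<close> change it by
  \<open>d\<omega> - \<eta>\<^sub>Y\<close> (\<open>lead_defect_update\<close>), so it can be cancelled order by order. Finally, a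
  deformation equivalent to \<open>ab\<close> would be associative, and \<open>ab + t (tr b)[X,a]\<close> is not when \<open>X\<close>
  is a diagonal matrix unit and \<open>n \<ge> 2\<close>.

  Throughout, \<open>K((t))\<close>-linear maps are controlled by their values on matrices over \<open>K\<close>, and
  computations modulo powers of \<open>t\<close> are done with the relation \<open>lead k A a\<close>, meaning
  \<open>A = t\<^sup>k a + O(t\<^bsup>k+1\<^esup>)\<close>.
\<close>

(* From here on $ selects components of vectors, not coefficients of power series. *)
unbundle no Formal_Power_Series.fps_syntax

section \<open>Linear algebra of matrices and matrix units\<close>

lemma mscale_nth [simp]: "mscale c A $ i $ j = c * A $ i $ j"
  by (simp add: mscale_def)

lemma mscale_0 [simp]: "mscale 0 A = 0" "mscale c 0 = 0"
  by (simp_all add: vec_eq_iff)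

lemma mscale_1 [simp]: "mscale 1 A = A"
  by (simp add: vec_eq_iff)

lemma mscale_mscale [simp]: "mscale c (mscale d A) = mscale (c * d) A"
  by (simp add: vec_eq_iff mult.assoc)

lemma mscale_distribs:
  fixes A B :: "'a::comm_ring_1^'n^'n"
  shows "mscale c (A + B) = mscale c A + mscale c B"
    and "mscale c (A - B) = mscale c A - mscale c B"
    and "mscale (c + d) A = mscale c A + mscale d A"
    and "mscale (c - d) A = mscale c A - mscale d A"
    and "mscale c (- A) = - mscale c A"
  by (simp_all add: vec_eq_iff algebra_simps)

lemma mscale_sum: "mscale c (sum f S) = (\<Sum>x\<in>S. mscale c (f x))"
  for c :: "'a::comm_ring_1"
  by (simp add: vec_eq_iff sum_distrib_left)

lemma mscale_mult:
  fixes A B :: "'a::comm_ring_1^'n^'n"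
  shows "mscale c A ** B = mscale c (A ** B)" and "A ** mscale c B = mscale c (A ** B)"
  by (simp_all add: vec_eq_iff matrix_matrix_mult_def sum_distrib_left mult_ac)

lemma matrix_mult_zero [simp]: "(0::'a::ring_1^'n^'n) ** A = 0" "A ** 0 = 0"
  by (simp_all add: vec_eq_iff matrix_matrix_mult_def)

lemma matrix_mult_distribs:
  fixes A B C :: "'a::ring_1^'n^'n"
  shows "(A + B) ** C = A ** C + B ** C" and "A ** (B + C) = A ** B + A ** C"
    and "(A - B) ** C = A ** C - B ** C" and "A ** (B - C) = A ** B - A ** C"
    and "(- A) ** C = - (A ** C)" and "A ** (- C) = - (A ** C)"
  by (simp_all add: vec_eq_iff matrix_matrix_mult_def algebra_simps sum.distrib sum_subtractf sum_negf)

lemma matrix_mult_sums: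
  fixes A :: "'a::ring_1^'n^'n"
  shows "sum f S ** A = (\<Sum>x\<in>S. f x ** A)" and "A ** sum f S = (\<Sum>x\<in>S. A ** f x)"
  by (induction S rule: infinite_finite_induct) (simp_all add: matrix_mult_distribs)

lemmas matrix_algebra = matrix_mult_distribs matrix_mul_assoc mscale_mult mscale_distribs

lemma trace_mscale [simp]: "trace (mscale c A) = c * trace A"
  by (simp add: trace_def sum_distrib_left)

lemma trace_mult_commute: "trace (A ** B) = trace (B ** A)" for A B :: "'a::comm_ring_1^'n^'n"
  by (rule trace_mul_sym)

lemma trace_mcomm [simp]: "trace (mcomm A B) = 0" for A :: "'a::comm_ring_1^'n^'n"
  by (simp add: mcomm_def trace_sub trace_mult_commute)

lemma vector_space_mscale: "vector_space (mscale :: 'a::field \<Rightarrow> 'a^'n^'n \<Rightarrow> _)"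
  by unfold_locales (simp_all add: mscale_distribs)

lemma mlinear_iff:
  "mlinear f \<longleftrightarrow> (\<forall>a b. f (a + b) = f a + f b) \<and> (\<forall>c a. f (mscale c a) = mscale c (f a))"
  by (simp add: Vector_Spaces.linear_iff vector_space_mscale)

lemma mlinearI:
  assumes "\<And>a b. f (a + b) = f a + f b" and "\<And>c a. f (mscale c a) = mscale c (f a)"
  shows "mlinear f"
  using assms by (simp add: mlinear_iff)

lemma mlinear_simps:
  assumes "mlinear f"
  shows "f (a + b) = f a + f b" and "f (a - b) = f a - f b" and "f (- a) = - f a"
    and "f (mscale c a) = mscale c (f a)" and "f 0 = 0" and "f (sum h S) = (\<Sum>x\<in>S. f (h x))"
proof -
  interpret module_hom mscale mscale f
    using assms by (simp add: linear_iff_module_hom)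
  show "f (a + b) = f a + f b" "f (a - b) = f a - f b" "f (- a) = - f a"
    "f (mscale c a) = mscale c (f a)" "f 0 = 0" "f (sum h S) = (\<Sum>x\<in>S. f (h x))"
    by (fact add diff neg scale zero sum)+
qed

lemma mbilinearI:
  assumes "\<And>a. mlinear (f a)" and "\<And>b. mlinear (\<lambda>a. f a b)"
  shows "mbilinear f"
  using assms by (simp add: mbilinear_def)

lemma mbilinear_right: "mbilinear f \<Longrightarrow> mlinear (f a)"
  and mbilinear_left: "mbilinear f \<Longrightarrow> mlinear (\<lambda>a. f a b)"
  by (simp_all add: mbilinear_def)

lemmas mbilinear_simps =
  mlinear_simps[OF mbilinear_right] mlinear_simps[OF mbilinear_left]

definition munit :: "'n \<Rightarrow> 'n \<Rightarrow> 'a::ring_1^'n^'n" where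
  "munit p q = (\<chi> i j. if i = p \<and> j = q then 1 else 0)"

lemma munit_nth [simp]: "munit p q $ i $ j = (if i = p \<and> j = q then 1 else 0)"
  by (simp add: munit_def)

lemma matrix_expand: "A = (\<Sum>p\<in>UNIV. \<Sum>q\<in>UNIV. mscale (A $ p $ q) (munit p q))"
  for A :: "'a::comm_ring_1^'n^'n"
proof -
  have "A $ i $ j = (\<Sum>p\<in>UNIV. \<Sum>q\<in>UNIV. A $ p $ q * (if i = p \<and> j = q then 1 else 0))" for i j
  proof -
    have "(\<Sum>p\<in>UNIV. \<Sum>q\<in>UNIV. A $ p $ q * (if i = p \<and> j = q then 1 else 0))
        = (\<Sum>p\<in>UNIV. \<Sum>q\<in>UNIV. if j = q then if i = p then A $ p $ q else 0 else 0)"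
      by (intro sum.cong refl) auto
    then show ?thesis by simp
  qed
  then show ?thesis
    unfolding vec_eq_iff sum_component mscale_nth munit_nth by blast
qed

lemma munit_mult: "munit p q ** munit r s = (if q = r then munit p s else (0::'a::comm_ring_1^'n^'n))"
proof -
  have "(\<Sum>k\<in>UNIV. (if i = p \<and> k = q then 1 else 0) * (if k = r \<and> j = s then 1 else 0))
      = (\<Sum>k\<in>UNIV. if k = q then (if i = p \<and> q = r \<and> j = s then 1 else (0::'a)) else 0)" for i j
    by (intro sum.cong) auto
  then show ?thesis
    by (auto simp: vec_eq_iff matrix_matrix_mult_def)
qed

lemma munit_mult_left: "b ** munit p q = (\<Sum>s\<in>UNIV. mscale (b $ s $ p) (munit s q))"
  for b :: "'a::comm_ring_1^'n^'n"
proof -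
  have "(\<Sum>k\<in>UNIV. b $ i $ k * (if k = p \<and> j = q then 1 else 0))
      = (\<Sum>k\<in>UNIV. if k = p then (if j = q then b $ i $ p else 0) else 0)" for i j
    by (intro sum.cong) auto
  moreover have "(\<Sum>s\<in>UNIV. b $ s $ p * (if i = s \<and> j = q then 1 else 0))
      = (\<Sum>s\<in>UNIV. if i = s then (if j = q then b $ i $ p else 0) else 0)" for i j
    by (intro sum.cong) auto
  ultimately show ?thesis
    by (simp add: vec_eq_iff matrix_matrix_mult_def)
qed

lemma munit_mult_right: "munit p q ** b = (\<Sum>s\<in>UNIV. mscale (b $ q $ s) (munit p s))"
  for b :: "'a::comm_ring_1^'n^'n"
proof -
  have "(\<Sum>k\<in>UNIV. (if i = p \<and> k = q then 1 else 0) * b $ k $ j)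
      = (\<Sum>k\<in>UNIV. if k = q then (if i = p then b $ q $ j else 0) else 0)" for i j
    by (intro sum.cong) auto
  moreover have "(\<Sum>s\<in>UNIV. b $ q $ s * (if i = p \<and> j = s then 1 else 0))
      = (\<Sum>s\<in>UNIV. if j = s then (if i = p then b $ q $ j else 0) else 0)" for i j
    by (intro sum.cong) auto
  ultimately show ?thesis
    by (simp add: vec_eq_iff matrix_matrix_mult_def)
qed

lemma trace_munit: "trace (munit p q) = (if p = q then 1 else (0::'a::comm_ring_1))"
proof -
  have "(\<Sum>k\<in>UNIV. if k = p \<and> k = q then 1 else (0::'a)) = (\<Sum>k\<in>UNIV. if k = p then (if p = q then 1 else 0) else 0)"
    by (intro sum.cong) auto
  then show ?thesis by (simp add: trace_def)
qed

section \<open>The Casimir element\<close>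

text \<open>
  The sums below run over the Casimir element \<open>\<Sum> e\<^sub>p\<^sub>q \<otimes> e\<^sub>q\<^sub>p\<close> of
  \<open>gl\<^sub>n \<otimes> gl\<^sub>n\<close>, fed into a bilinear map. Divided by \<open>n\<close> it is a separability idempotent of
  the matrix algebra: a factor can be moved from the outside of one leg to the outside of the
  other, or from the inside of one to the inside of the other, and its product is \<open>1\<close>.
  Contracting cochains with it provides explicit primitives, as in the proof that the Hochschild
  cohomology of a separable algebra vanishes.
\<close>

lemma casimir_move:
  assumes F: "mbilinear (F :: 'a::field^'n^'n \<Rightarrow> 'a^'n^'n \<Rightarrow> 'a^'n^'n)"
  shows "(\<Sum>p\<in>UNIV. \<Sum>q\<in>UNIV. F (munit p q) (munit q p ** b))
       = (\<Sum>p\<in>UNIV. \<Sum>q\<in>UNIV. F (b ** munit p q) (munit q p))"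
proof -
  have "(\<Sum>p\<in>UNIV. \<Sum>q\<in>UNIV. F (munit p q) (munit q p ** b))
      = (\<Sum>p\<in>UNIV. \<Sum>q\<in>UNIV. \<Sum>s\<in>UNIV. mscale (b $ p $ s) (F (munit p q) (munit q s)))"
    by (simp add: munit_mult_right mbilinear_simps[OF F])
  also have "\<dots> = (\<Sum>p\<in>UNIV. \<Sum>s\<in>UNIV. \<Sum>q\<in>UNIV. mscale (b $ p $ s) (F (munit p q) (munit q s)))"
    by (intro sum.cong refl sum.swap)
  also have "\<dots> = (\<Sum>s\<in>UNIV. \<Sum>p\<in>UNIV. \<Sum>q\<in>UNIV. mscale (b $ p $ s) (F (munit p q) (munit q s)))"
    by (rule sum.swap)
  also have "\<dots> = (\<Sum>s\<in>UNIV. \<Sum>q\<in>UNIV. \<Sum>p\<in>UNIV. mscale (b $ p $ s) (F (munit p q) (munit q s)))"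
    by (intro sum.cong refl sum.swap)
  also have "\<dots> = (\<Sum>p\<in>UNIV. \<Sum>q\<in>UNIV. F (b ** munit p q) (munit q p))"
    by (simp add: munit_mult_left mbilinear_simps[OF F])
  finally show ?thesis .
qed

lemma casimir_move_inner:
  assumes F: "mbilinear (F :: 'a::field^'n^'n \<Rightarrow> 'a^'n^'n \<Rightarrow> 'a^'n^'n)"
  shows "(\<Sum>p\<in>UNIV. \<Sum>q\<in>UNIV. F (munit p q ** b) (munit q p))
       = (\<Sum>p\<in>UNIV. \<Sum>q\<in>UNIV. F (munit p q) (b ** munit q p))"
proof -
  have "mbilinear (\<lambda>a b. F b a)" using F by (simp add: mbilinear_def)
  from casimir_move[OF this, of b] show ?thesis
    by (subst (1 2) sum.swap)
qed

lemma casimir_mult: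
  "(\<Sum>p\<in>UNIV. \<Sum>q\<in>UNIV. munit p q ** (munit q p ** a)) = mscale (of_nat CARD('n)) a"
  for a :: "'a::comm_ring_1^'n^'n"
proof -
  have "(\<Sum>p\<in>UNIV. \<Sum>q\<in>UNIV. munit p q ** (munit q p ** a))
      = (\<Sum>q\<in>(UNIV::'n set). (\<Sum>p\<in>UNIV. munit p p) ** a)"
    by (subst sum.swap) (simp add: matrix_mul_assoc munit_mult matrix_mult_sums)
  also have "(\<Sum>p\<in>UNIV. munit p p) = (mat 1 :: 'a^'n^'n)"
  proof -
    have "(\<Sum>p\<in>UNIV. if i = p \<and> j = p then 1 else (0::'a)) 
       = (\<Sum>p\<in>UNIV. if i = p then (if i = j then 1 else 0) else 0)" for i j :: 'n
      by (intro sum.cong) auto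
    then show ?thesis by (simp add: vec_eq_iff mat_def)
  qed
  also have "(\<Sum>q\<in>(UNIV::'n set). mat 1 ** a) = mscale (of_nat CARD('n)) a"
    by (simp add: vec_eq_iff del: sum_constant) simp
  finally show ?thesis .
qed

lemma casimir_sandwich:
  "(\<Sum>p\<in>UNIV. \<Sum>q\<in>UNIV. munit p q ** a ** munit q p) = mscale (trace a) (mat 1)"
  for a :: "'a::comm_ring_1^'n^'n"
proof -
  have 1: "munit p q ** a ** munit q p = mscale (a $ q $ q) (munit p p)" for p q
  proof -
    have "munit p q ** a ** munit q p = (\<Sum>s\<in>UNIV. mscale (a $ q $ s) (munit p s ** munit q p))"
      by (subst munit_mult_right) (simp only: matrix_mult_sums mscale_mult)
    also have "\<dots> = (\<Sum>s\<in>UNIV. if s = q then mscale (a $ q $ q) (munit p p) else 0)"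
      by (intro sum.cong) (auto simp: munit_mult)
    finally show ?thesis by simp
  qed
  have "(\<Sum>p\<in>UNIV. \<Sum>q\<in>UNIV. a $ q $ q * (if i = p \<and> j = p then 1 else 0))
     = trace a * (if i = j then 1 else 0)" for i j :: 'n
  proof -
    have "(\<Sum>p\<in>UNIV. \<Sum>q\<in>UNIV. a $ q $ q * (if i = p \<and> j = p then 1 else 0))
       = (\<Sum>p\<in>UNIV. if p = i then if i = j then \<Sum>q\<in>UNIV. a $ q $ q else 0 else 0)"
      by (intro sum.cong) auto
    then show ?thesis by (simp add: trace_def)
  qed
  then show ?thesis
    by (simp only: 1 vec_eq_iff sum_component mscale_nth munit_nth mat_def vec_lambda_beta) simp
qed

text \<open>
  Apply \<open>L\<close> to \<open>tr(a) 1 = \<Sum> e\<^sub>p\<^sub>q a e\<^sub>q\<^sub>p\<close>: rotating the factors under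
  \<open>L\<close> turns the sum into \<open>n a\<close>.
\<close>

lemma central_functional_eq_trace:
  fixes L :: "'a::field_char_0^'n^'n \<Rightarrow> 'a^'n^'n"
  assumes L: "mlinear L" and comm: "\<And>a b. L (a ** b) = L (b ** a)"
  shows "L a = mscale (trace a) (mscale (1 / of_nat CARD('n)) (L (mat 1)))"
proof -
  have "mscale (trace a) (L (mat 1)) = L (\<Sum>p\<in>UNIV. \<Sum>q\<in>UNIV. munit p q ** a ** munit q p)"
    by (simp add: casimir_sandwich mlinear_simps[OF L])
  also have "\<dots> = L (\<Sum>q\<in>UNIV. \<Sum>p\<in>UNIV. munit q p ** (munit p q ** a))"
    by (simp add: mlinear_simps[OF L] comm[of _ "munit _ _"]) (rule sum.swap)
  also have "\<dots> = mscale (of_nat CARD('n)) (L a)"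
    by (simp only: casimir_mult mlinear_simps[OF L])
  finally have "mscale (of_nat CARD('n)) (L a) = mscale (trace a) (L (mat 1))" ..
  then have "mscale (1 / of_nat CARD('n)) (mscale (of_nat CARD('n)) (L a)) 
      = mscale (1 / of_nat CARD('n)) (mscale (trace a) (L (mat 1)))" by simp
  then show ?thesis by (simp add: mult.commute)
qed

section \<open>Right-symmetric 2-cocycles\<close>

lemma mlinear_add: "mlinear f \<Longrightarrow> mlinear g \<Longrightarrow> mlinear (\<lambda>x. f x + g x)"
  and mlinear_diff: "mlinear f \<Longrightarrow> mlinear g \<Longrightarrow> mlinear (\<lambda>x. f x - g x)"
  and mlinear_uminus: "mlinear f \<Longrightarrow> mlinear (\<lambda>x. - f x)"
  and mlinear_id: "mlinear (\<lambda>x. x)"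
  by (simp_all add: mlinear_iff mscale_distribs mult.commute)

lemma mlinear_zero: "mlinear (\<lambda>x. 0)" by (simp add: mlinear_iff)

lemma mlinear_trace: "mlinear (\<lambda>x. mscale (trace x) X)"
  by (rule mlinearI) (simp_all add: trace_add mscale_distribs mult.commute)

lemma mbilinear_eta: "mbilinear (eta X)"
  by (rule mbilinearI; rule mlinearI)
    (simp_all add: eta_def mcomm_def matrix_algebra trace_add algebra_simps)

lemma local_deformation_eta: "local_deformation (eta X)"
  unfolding local_deformation_def
  by (auto simp: mbilinear_eta) (auto simp: eta_def mcomm_def matrix_algebra trace_sub trace_mult_commute)

lemma mbilinear_coboundary: "mlinear \<omega> \<Longrightarrow> mbilinear (coboundary \<omega>)"
  by (rule mbilinearI; rule mlinearI)
    (simp_all add: coboundary_def mlinear_simps matrix_algebra algebra_simps)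

lemma local_deformation_coboundary:
  assumes "mlinear \<omega>" shows "local_deformation (coboundary \<omega>)"
  unfolding local_deformation_def
  by (auto simp: mbilinear_coboundary assms)
    (auto simp: coboundary_def mcomm_def matrix_algebra mlinear_simps[OF assms])

lemma mbilinear_diff: "mbilinear f \<Longrightarrow> mbilinear g \<Longrightarrow> mbilinear (\<lambda>a b. f a b - g a b)"
  by (simp add: mbilinear_def mlinear_diff)

lemma local_deformation_diff:
  assumes "local_deformation \<phi>" "local_deformation \<psi>"
  shows "local_deformation (\<lambda>a b. \<phi> a b - \<psi> a b)"
proof -
  let ?Z = "\<lambda>\<psi> a b c. a ** \<psi> b c - a ** \<psi> c b - \<psi> (a ** b) c + \<psi> (a ** c) b
        + \<psi> a (mcomm b c) - \<psi> a b ** c + \<psi> a c ** b"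
  have "?Z (\<lambda>a b. \<phi> a b - \<psi> a b) a b c = ?Z \<phi> a b c - ?Z \<psi> a b c" for a b c
    by (simp add: matrix_algebra algebra_simps)
  with assms show ?thesis
    unfolding local_deformation_def by (simp add: mbilinear_diff)
qed

text \<open>
  The cocycle condition says precisely that the Hochschild coboundary
  \<open>f(a,b,c) = a \<psi>(b,c) - \<psi>(ab,c) + \<psi>(a,bc) - \<psi>(a,b)c\<close> is symmetric in \<open>b\<close> and \<open>c\<close>.
  The usual contraction of a Hochschild cochain along the Casimir element gives
  \<open>\<Sum> e\<^sub>p\<^sub>q f(e\<^sub>q\<^sub>p,b,c) / n = \<psi>(b,c) - d\<omega>(b,c)\<close> for a suitable \<open>\<omega>\<close>, and
  the left-hand side inherits the symmetry of \<open>f\<close>.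
\<close>

lemma cocycle_cohomologous_to_symmetric:
  fixes \<psi> :: "'a::field_char_0^'n^'n \<Rightarrow> 'a^'n^'n \<Rightarrow> 'a^'n^'n"
  assumes \<psi>: "local_deformation \<psi>"
  obtains \<omega> where "mlinear \<omega>"
    and "\<And>b c. \<psi> b c - coboundary \<omega> b c = \<psi> c b - coboundary \<omega> c b"
proof -
  have bil: "mbilinear \<psi>" using \<psi> by (simp add: local_deformation_def)
  note lin = mbilinear_simps[OF bil]
  define \<kappa> :: "(('a^'n^'n) \<Rightarrow> ('a^'n^'n) \<Rightarrow> 'a^'n^'n) \<Rightarrow> 'a^'n^'n"
    where "\<kappa> F = mscale (1 / of_nat CARD('n)) (\<Sum>p\<in>UNIV. \<Sum>q\<in>UNIV. F (munit p q) (munit q p))" for F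
  define \<omega> where "\<omega> c = \<kappa> (\<lambda>x y. x ** \<psi> y c)" for c
  define f where "f a b c = a ** \<psi> b c - \<psi> (a ** b) c + \<psi> a (b ** c) - \<psi> a b ** c" for a b c
  have f_sym: "f a b c = f a c b" for a b c
  proof -
    have "a ** \<psi> b c - a ** \<psi> c b - \<psi> (a ** b) c + \<psi> (a ** c) b
        + \<psi> a (mcomm b c) - \<psi> a b ** c + \<psi> a c ** b = 0"
      using \<psi> by (simp add: local_deformation_def)
    then show ?thesis
      by (simp add: f_def mcomm_def lin algebra_simps)
  qed
  have lin_\<omega>: "mlinear \<omega>"
    by (rule mlinearI)
      (simp_all add: \<omega>_def \<kappa>_def lin matrix_algebra sum.distrib mscale_sum mult.commute)
  have eq: "\<psi> b c - coboundary \<omega> b c = \<kappa> (\<lambda>x y. x ** f y b c)" for b c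
  proof -
    have 1: "\<kappa> (\<lambda>x y. x ** (y ** \<psi> b c)) = \<psi> b c"
      by (simp add: \<kappa>_def casimir_mult)
    have 2: "\<kappa> (\<lambda>x y. x ** \<psi> (y ** b) c) = b ** \<omega> c"
    proof -
      have "mbilinear (\<lambda>x y. x ** \<psi> y c)"
        by (rule mbilinearI; rule mlinearI) (simp_all add: lin matrix_algebra)
      from casimir_move[OF this, of b] show ?thesis
        by (simp add: \<kappa>_def \<omega>_def matrix_mult_sums mscale_mult matrix_mul_assoc)
    qed
    have 3: "\<kappa> (\<lambda>x y. x ** \<psi> y b ** c) = \<omega> b ** c"
      by (simp add: \<kappa>_def \<omega>_def matrix_mult_sums mscale_mult)
    have "\<kappa> (\<lambda>x y. x ** f y b c) = \<kappa> (\<lambda>x y. x ** (y ** \<psi> b c)) - \<kappa> (\<lambda>x y. x ** \<psi> (y ** b) c)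
        + \<omega> (b ** c) - \<kappa> (\<lambda>x y. x ** \<psi> y b ** c)"
      by (simp add: f_def \<kappa>_def \<omega>_def matrix_algebra sum.distrib sum_subtractf)
    then show ?thesis
      by (simp add: 1 2 3 coboundary_def)
  qed
  have sym: "\<psi> b c - coboundary \<omega> b c = \<psi> c b - coboundary \<omega> c b" for b c
    unfolding eq f_sym[of _ c b] ..
  show thesis
    by (rule that[OF lin_\<omega> sym])
qed

text \<open>
  For a symmetric cocycle the terms with a factor on the left cancel, and what remains involves
  only right multiplication of values. Put \<open>c = e\<^sub>p\<^sub>q\<close>, multiply by \<open>e\<^sub>q\<^sub>p\<close> on the
  right and sum: with \<open>L(x) = \<Sum> \<phi>(x,e\<^sub>p\<^sub>q) e\<^sub>q\<^sub>p\<close> this gives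
  \<open>n \<phi>(a,b) = L(a)b + L(b)a - L(ab)\<close>. By symmetry \<open>L(ab) = L(ba)\<close>, hence \<open>L\<close> is the trace
  times a fixed matrix.
\<close>

lemma symmetric_cocycle_form:
  fixes \<phi> :: "'a::field_char_0^'n^'n \<Rightarrow> 'a^'n^'n \<Rightarrow> 'a^'n^'n"
  assumes \<phi>: "local_deformation \<phi>" and sym: "\<And>a b. \<phi> a b = \<phi> b a"
  obtains X where "\<And>a b. \<phi> a b = mscale (trace a) (X ** b) + mscale (trace b) (X ** a) - mscale (trace (a ** b)) X"
proof -
  let ?n = "of_nat CARD('n) :: 'a"
  have bil: "mbilinear \<phi>" using \<phi> by (simp add: local_deformation_def)
  note lin = mbilinear_simps[OF bil]
  define \<kappa> :: "(('a^'n^'n) \<Rightarrow> ('a^'n^'n) \<Rightarrow> 'a^'n^'n) \<Rightarrow> 'a^'n^'n"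
    where "\<kappa> F = (\<Sum>p\<in>UNIV. \<Sum>q\<in>UNIV. F (munit p q) (munit q p))" for F
  define L where "L x = \<kappa> (\<lambda>u v. \<phi> x u ** v)" for x
  have L: "mlinear L"
    by (rule mlinearI) (simp_all add: L_def \<kappa>_def lin matrix_algebra sum.distrib mscale_sum)
  have bil': "mbilinear (\<lambda>u v. \<phi> x u ** v)" for x
    by (rule mbilinearI; rule mlinearI) (simp_all add: lin matrix_algebra)
  have cocycle: "\<phi> (a ** b) c + \<phi> a b ** c - \<phi> (a ** c) b - \<phi> a c ** b - \<phi> a (b ** c) + \<phi> a (c ** b) = 0" for a b c
  proof -
    have "a ** \<phi> b c - a ** \<phi> c b - \<phi> (a ** b) c + \<phi> (a ** c) b
        + \<phi> a (mcomm b c) - \<phi> a b ** c + \<phi> a c ** b = 0"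
      using \<phi> by (simp add: local_deformation_def)
    then show ?thesis
      by (simp add: sym[of c b] mcomm_def lin algebra_simps)
  qed
  have main: "mscale ?n (\<phi> a b) = L a ** b + L b ** a - L (a ** b)" for a b
  proof -
    have "\<kappa> (\<lambda>u v. (\<phi> (a ** b) u + \<phi> a b ** u - \<phi> (a ** u) b - \<phi> a u ** b
        - \<phi> a (b ** u) + \<phi> a (u ** b)) ** v) = 0"
      by (simp add: cocycle \<kappa>_def)
    then have "L (a ** b) + \<kappa> (\<lambda>u v. \<phi> a b ** u ** v) - \<kappa> (\<lambda>u v. \<phi> (a ** u) b ** v) 
        - \<kappa> (\<lambda>u v. \<phi> a u ** b ** v) - \<kappa> (\<lambda>u v. \<phi> a (b ** u) ** v) + \<kappa> (\<lambda>u v. \<phi> a (u ** b) ** v) = 0"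
      by (simp add: \<kappa>_def L_def matrix_mult_distribs sum.distrib sum_subtractf)
    moreover have "\<kappa> (\<lambda>u v. \<phi> a b ** u ** v) = mscale ?n (\<phi> a b)"
    proof -
      have "\<kappa> (\<lambda>u v. \<phi> a b ** u ** v) = \<phi> a b ** (\<Sum>p\<in>UNIV. \<Sum>q\<in>UNIV. munit p q ** (munit q p ** mat 1))"
        unfolding \<kappa>_def by (simp add: matrix_mult_sums matrix_mul_assoc)
      then show ?thesis
        using casimir_mult[of "mat 1 :: 'a^'n^'n"] by (simp add: mscale_mult)
    qed
    moreover have "\<kappa> (\<lambda>u v. \<phi> (a ** u) b ** v) = L b ** a"
      using casimir_move[OF bil', of b a]
      by (simp add: \<kappa>_def L_def sym[of _ b] matrix_mult_sums matrix_mul_assoc)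
    moreover have "\<kappa> (\<lambda>u v. \<phi> a (b ** u) ** v) = L a ** b"
      using casimir_move[OF bil', of a b]
      by (simp add: \<kappa>_def L_def matrix_mult_sums matrix_mul_assoc)
    moreover have "\<kappa> (\<lambda>u v. \<phi> a (u ** b) ** v) = \<kappa> (\<lambda>u v. \<phi> a u ** b ** v)"
      using casimir_move_inner[OF bil', of a b] by (simp add: \<kappa>_def matrix_mul_assoc)
    ultimately show ?thesis
      by (simp add: algebra_simps)
  qed
  have "L (a ** b) = L (b ** a)" for a b
  proof -
    have "L (u ** v) = L u ** v + L v ** u - mscale ?n (\<phi> u v)" for u v
      by (simp add: main)
    from this[of a b] this[of b a] show ?thesis
      by (simp add: sym[of b a])
  qed
  then obtain Y where Y: "\<And>a. L a = mscale (trace a) Y"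
    using central_functional_eq_trace[OF L] by blast
  have "\<phi> a b = mscale (1 / ?n) (mscale ?n (\<phi> a b))" for a b
    by simp
  then have "\<phi> a b = mscale (1 / ?n) (mscale (trace a) (Y ** b) + mscale (trace b) (Y ** a) - mscale (trace (a ** b)) Y)" for a b
    by (simp only: main Y mscale_mult)
  then show thesis
    by (intro that[of "mscale (1 / ?n) Y"]) (simp add: matrix_algebra mult.commute)
qed

text \<open>
  With \<open>\<omega>(a) = (tr a) X\<close>, the normal form of a symmetric cocycle is \<open>d\<omega> + \<eta>\<^sub>X\<close>.
  Only the class of \<open>X\<close> modulo scalar matrices enters \<open>\<eta>\<^sub>X\<close>, so the trace of \<open>X\<close> can be
  removed; this and the division by \<open>n\<close> above use characteristic 0.
\<close>

theorem cocycle_classification: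
  fixes \<psi> :: "'a::field_char_0^'n^'n \<Rightarrow> 'a^'n^'n \<Rightarrow> 'a^'n^'n"
  assumes \<psi>: "local_deformation \<psi>"
  shows "\<exists>X\<in>sl. cocycle_equiv \<psi> (eta X)"
proof -
  let ?n = "of_nat CARD('n) :: 'a"
  obtain \<omega> where \<omega>: "mlinear \<omega>"
    and sym: "\<And>b c. \<psi> b c - coboundary \<omega> b c = \<psi> c b - coboundary \<omega> c b"
    using cocycle_cohomologous_to_symmetric[OF \<psi>] by blast
  obtain X where X: "\<And>a b. \<psi> a b - coboundary \<omega> a b 
      = mscale (trace a) (X ** b) + mscale (trace b) (X ** a) - mscale (trace (a ** b)) X"
    using symmetric_cocycle_form[OF local_deformation_diff[OF \<psi> local_deformation_coboundary[OF \<omega>]] sym] by blast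
  define X' where "X' = X - mscale (trace X / ?n) (mat 1)"
  define \<omega>' where "\<omega>' a = \<omega> a + mscale (trace a) X" for a
  have "X' \<in> sl"
    by (simp add: sl_def X'_def trace_sub trace_I)
  moreover have "mlinear \<omega>'"
    unfolding \<omega>'_def by (intro mlinear_add mlinear_trace \<omega>)
  moreover have "\<psi> a b - eta X' a b = coboundary \<omega>' a b" for a b
  proof -
    have "eta X' a b = mscale (trace b) (X ** a - a ** X)"
      by (simp add: eta_def mcomm_def X'_def matrix_algebra)
    then show ?thesis
      using X[of a b] by (simp add: coboundary_def \<omega>'_def matrix_algebra algebra_simps)
  qed
  ultimately show ?thesis
    unfolding cocycle_equiv_def by blast
qed

section \<open>Leading coefficients\<close>

definition mcoeff :: "'a::zero fls^'n^'n \<Rightarrow> int \<Rightarrow> 'a^'n^'n" where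
  "mcoeff A k = (\<chi> i j. fls_nth (A $ i $ j) k)"

lemma mcoeff_nth [simp]: "mcoeff A k $ i $ j = fls_nth (A $ i $ j) k"
  by (simp add: mcoeff_def)

text \<open>
  \<open>lead k A a\<close> says \<open>A = t\<^sup>k a + O(t\<^bsup>k+1\<^esup>)\<close>. The value \<open>a = 0\<close> is
  permitted, so that \<open>lead k A 0\<close> expresses \<open>A = O(t\<^bsup>k+1\<^esup>)\<close>. In this form the relation is
  compatible with all algebraic operations without case distinctions, and congruences modulo
  powers of \<open>t\<close> become rules about the pair \<open>(A, a)\<close>.
\<close>

definition lead :: "int \<Rightarrow> 'a::zero fls^'n^'n \<Rightarrow> 'a^'n^'n \<Rightarrow> bool" where
  "lead k A a \<longleftrightarrow> (\<forall>m<k. mcoeff A m = 0) \<and> mcoeff A k = a"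

definition slead :: "int \<Rightarrow> 'a::zero fls \<Rightarrow> 'a \<Rightarrow> bool" where
  "slead k x c \<longleftrightarrow> (\<forall>m<k. fls_nth x m = 0) \<and> fls_nth x k = c"

lemma lead_iff_slead: "lead k A a \<longleftrightarrow> (\<forall>i j. slead k (A $ i $ j) (a $ i $ j))"
  by (auto simp: lead_def slead_def vec_eq_iff)

lemma lead_mcoeff: "lead k A a \<Longrightarrow> mcoeff A k = a"
  by (simp add: lead_def)

lemma lead_unique: "lead k A a \<Longrightarrow> lead k A b \<Longrightarrow> a = b"
  by (auto simp: lead_def)

lemma mcoeff_eq_0_imp: "(\<And>k. mcoeff A k = 0) \<Longrightarrow> A = 0"
  by (auto simp: vec_eq_iff intro: fls_eqI)

lemma lead_lower: "lead k A a \<Longrightarrow> j < k \<Longrightarrow> lead j A 0"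
  by (auto simp: lead_def)

lemma lead_0 [simp]: "lead k (0 :: 'a::zero fls^'n^'n) 0"
  by (simp add: lead_def vec_eq_iff)

lemma slead_sum: "(\<And>i. i \<in> S \<Longrightarrow> slead k (f i) (c i)) \<Longrightarrow> slead k (sum f S) (sum c S)"
  for f :: "_ \<Rightarrow> 'a::comm_ring_1 fls"
  by (induction S rule: infinite_finite_induct) (simp_all add: slead_def)

lemma slead_mult:
  fixes x y :: "'a::comm_ring_1 fls"
  assumes x: "slead i x c" and y: "slead j y d"
  shows "slead (i + j) (x * y) (c * d)"
proof (cases "x = 0 \<or> y = 0")
  case True
  then show ?thesis using x y by (auto simp: slead_def)
next
  case False
  have i: "i \<le> fls_subdegree x" and j: "j \<le> fls_subdegree y"
    using x y False by (auto intro!: fls_subdegree_geI simp: slead_def)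
  show ?thesis
  proof (cases "i = fls_subdegree x \<and> j = fls_subdegree y")
    case True
    then show ?thesis
      using x y by (auto simp: slead_def fls_times_nth_eq0)
  next
    case False
    with i j have lt: "i + j < fls_subdegree x + fls_subdegree y" by linarith
    from False i j have "i < fls_subdegree x \<or> j < fls_subdegree y" by linarith
    then have "c * d = 0"
      using x y by (auto simp: slead_def)
    with lt show ?thesis by (simp add: slead_def fls_times_nth_eq0)
  qed
qed

lemma lead_add: "lead k A a \<Longrightarrow> lead k B b \<Longrightarrow> lead k (A + B) (a + b)"
  and lead_diff: "lead k A a \<Longrightarrow> lead k B b \<Longrightarrow> lead k (A - B) (a - b)"
  for A B :: "'a::comm_ring_1 fls^'n^'n"
  by (simp_all add: lead_def vec_eq_iff)

lemma lead_sum: "(\<And>i. i \<in> S \<Longrightarrow> lead k (f i) (c i)) \<Longrightarrow> lead k (sum f S) (sum c S)"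
  for f :: "_ \<Rightarrow> 'a::comm_ring_1 fls^'n^'n"
  by (induction S rule: infinite_finite_induct) (simp_all add: lead_add)

lemma lead_mscale: "slead i x c \<Longrightarrow> lead j A a \<Longrightarrow> lead (i + j) (mscale x A) (mscale c a)"
  for x :: "'a::comm_ring_1 fls"
  by (simp add: lead_iff_slead slead_mult)

lemma lead_mult: "lead i A a \<Longrightarrow> lead j B b \<Longrightarrow> lead (i + j) (A ** B) (a ** b)"
  for A :: "'a::comm_ring_1 fls^'n^'n"
  by (simp add: lead_iff_slead matrix_matrix_mult_def slead_sum slead_mult)

lemma slead_trace: "lead k A a \<Longrightarrow> slead k (trace A) (trace a)"
  for A :: "'a::comm_ring_1 fls^'n^'n"
  by (simp add: trace_def lead_iff_slead slead_sum)

lemma lead_eta: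
  assumes "lead i Z z" "lead j A a" "lead k B b"
  shows "lead (i + j + k) (eta Z A B) (eta z a b)"
proof -
  have "lead (i + j) (mcomm Z A) (mcomm z a)"
    unfolding mcomm_def using assms lead_mult lead_diff by (metis add.commute)
  from lead_mscale[OF slead_trace[OF assms(3)] this] show ?thesis
    by (simp add: eta_def add.commute)
qed

lemma lead_mconst: "lead 0 (mconst a) a"
  by (simp add: lead_iff_slead slead_def mconst_def)

lemma mconst_simps:
  "mconst (a + b) = mconst a + mconst b" "mconst (mscale c a) = mscale (fls_const c) (mconst a)"
  "mconst (a ** b) = mconst a ** mconst b"
  by (auto simp: vec_eq_iff mconst_def matrix_matrix_mult_def fls_nth_sum intro!: fls_eqI)

lemma mcoeff_simps:
  fixes A :: "'a::comm_ring_1 fls^'n^'n"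
  shows "mcoeff (A + B) k = mcoeff A k + mcoeff B k" 
    and "mcoeff (mscale (fls_const c) A) k = mscale c (mcoeff A k)"
  by (simp_all add: vec_eq_iff)

lemma mconst_munit: "mconst (munit p q) = munit p q"
  by (auto simp: vec_eq_iff mconst_def intro!: fls_eqI)

lemma mlinear_expand:
  assumes "mlinear G"
  shows "G A = (\<Sum>p\<in>UNIV. \<Sum>q\<in>UNIV. mscale (A $ p $ q) (G (munit p q)))"
  by (subst matrix_expand[of A]) (simp only: mlinear_simps[OF assms])

text \<open>
  Matrices over \<open>K\<close> span the matrices over \<open>K((t))\<close>, so a \<open>K((t))\<close>-linear map is
  determined by its values on them.
\<close>

lemma mlinear_eqI:
  assumes "mlinear G" "mlinear H" "\<And>a. G (mconst a) = H (mconst a)"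
  shows "G A = H A"
  unfolding mlinear_expand[OF assms(1), of A] mlinear_expand[OF assms(2), of A]
  by (simp add: assms(3) flip: mconst_munit)

lemma mbilinear_eqI:
  assumes M: "mbilinear M" and N: "mbilinear N"
    and eq: "\<And>a b. M (mconst a) (mconst b) = N (mconst a) (mconst b)"
  shows "M A B = N A B"
  by (rule mlinear_eqI[OF mbilinear_left[OF M] mbilinear_left[OF N]])
    (rule mlinear_eqI[OF mbilinear_right[OF M] mbilinear_right[OF N] eq])

text \<open>
  Writing a matrix as a combination of matrix units shows that an order estimate for \<open>G\<close> on
  constant matrices extends to all matrices.
  The leading part \<open>\<gamma>\<close> is automatically linear, being a coefficient of \<open>G\<close>.
\<close>

lemma lead_mlinear:
  assumes G: "mlinear G" and const: "\<And>a. lead d (G (mconst a)) (\<gamma> a)" and A: "lead k A a"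
  shows "lead (k + d) (G A) (\<gamma> a)"
proof -
  have "\<gamma> = (\<lambda>a. mcoeff (G (mconst a)) d)"
    using const by (auto simp: lead_def)
  then have "mlinear \<gamma>"
    by (auto intro!: mlinearI simp: mconst_simps mlinear_simps[OF G] mcoeff_simps)
  moreover have "lead (k + d) (\<Sum>p\<in>UNIV. \<Sum>q\<in>UNIV. mscale (A $ p $ q) (G (munit p q)))
     (\<Sum>p\<in>UNIV. \<Sum>q\<in>UNIV. mscale (a $ p $ q) (\<gamma> (munit p q)))"
    using A const[of "munit _ _"] by (auto intro!: lead_sum lead_mscale simp: mconst_munit lead_iff_slead[of k])
  ultimately show ?thesis
    by (simp flip: mlinear_expand add: G)
qed

lemma lead_mbilinear:
  assumes M: "mbilinear M" and const: "\<And>a b. lead d (M (mconst a) (mconst b)) (\<mu> a b)"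
    and A: "lead i A a" and B: "lead j B b"
  shows "lead (i + j + d) (M A B) (\<mu> a b)"
proof -
  have "lead (j + d) (M (mconst a) B) (\<mu> a b)" for a
    by (rule lead_mlinear[OF mbilinear_right[OF M] const B])
  from lead_mlinear[of "\<lambda>A. M A B", OF mbilinear_left[OF M] this A] show ?thesis
    by (simp add: add.assoc)
qed

section \<open>Linear maps that reduce to the identity\<close>

lemma lead_exists:
  fixes A :: "'a::comm_ring_1 fls^'n^'n"
  assumes "A \<noteq> 0"
  obtains k a where "lead k A a" "a \<noteq> 0"
proof -
  \<comment> \<open>\<open>k\<close> is the least order of a nonzero entry.\<close>
  define S where "S = {(i, j). A $ i $ j \<noteq> 0}"
  define k where "k = Min ((\<lambda>(i, j). fls_subdegree (A $ i $ j)) ` S)"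
  have "S \<noteq> {}"
    using assms by (auto simp: S_def vec_eq_iff)
  then have "k \<in> (\<lambda>(i, j). fls_subdegree (A $ i $ j)) ` S"
    unfolding k_def by (intro Min_in) auto
  then obtain i j where ij: "A $ i $ j \<noteq> 0" "k = fls_subdegree (A $ i $ j)"
    by (auto simp: S_def)
  have "fls_nth (A $ i $ j) m = 0" if "m < k" for i j m
  proof (cases "A $ i $ j = 0")
    case False
    then have "k \<le> fls_subdegree (A $ i $ j)"
      unfolding k_def by (intro Min_le) (auto simp: S_def)
    with that show ?thesis by auto
  qed auto
  then have "lead k A (mcoeff A k)"
    by (simp add: lead_def vec_eq_iff)
  moreover have "mcoeff A k \<noteq> 0"
    using ij nth_fls_subdegree_nonzero by (metis mcoeff_nth zero_index)
  ultimately show thesis by (rule that)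
qed

text \<open>
  The dimension argument is applied to column vectors indexed by pairs, which are the matrices
  with their entries strung out.
\<close>

lemma mlinear_inj_imp_surj:
  fixes G :: "'a::field^'n^'n \<Rightarrow> 'a^'n^'n"
  assumes G: "mlinear G" and "inj G"
  shows "surj G"
proof -
  define unflat :: "'a^('n \<times> 'n) \<Rightarrow> 'a^'n^'n" where "unflat v = (\<chi> i j. v $ (i, j))" for v
  define flat :: "'a^'n^'n \<Rightarrow> 'a^('n \<times> 'n)" where "flat A = (\<chi> ij. A $ fst ij $ snd ij)" for A
  have [simp]: "flat (unflat v) = v" "unflat (flat A) = A" for v A
    by (simp_all add: flat_def unflat_def vec_eq_iff)
  have flat: "flat (A + B) = flat A + flat B" "flat (mscale c A) = c *s flat A" for A B c
    by (simp_all add: flat_def vec_eq_iff)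
  have unflat: "unflat (v + w) = unflat v + unflat w" "unflat (c *s v) = mscale c (unflat v)" for v w c
    by (simp_all add: unflat_def vec_eq_iff)
  define H where "H v = flat (G (unflat v))" for v
  have "Vector_Spaces.linear (*s) (*s) H"
    by (simp add: Vector_Spaces.linear_iff vec.vector_space_axioms H_def flat unflat mlinear_simps[OF G])
  moreover have "inj H"
    unfolding H_def
    by (rule injI) (metis \<open>inj G\<close> injD \<open>\<And>v. flat (unflat v) = v\<close> \<open>\<And>A. unflat (flat A) = A\<close>)
  ultimately have "surj H"
    by (rule vec.linear_inj_imp_surj)
  show "surj G"
  proof (rule surjI)
    fix B
    have "H (inv H (flat B)) = flat B"
      using \<open>surj H\<close> by (rule surj_f_inv_f)
    then show "G (unflat (inv H (flat B))) = B"
      by (metis H_def \<open>\<And>A. unflat (flat A) = A\<close>)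
  qed
qed

text \<open>
  A map \<open>G = id + O(t)\<close> preserves the leading term of a matrix, so it has no kernel.
\<close>

lemma unipotent_bij:
  assumes G: "mlinear G" and G0: "\<And>a. lead 0 (G (mconst a)) a"
  shows "bij G"
proof -
  have "A = 0" if "G A = 0" for A
  proof (rule ccontr)
    assume "A \<noteq> 0"
    then obtain k a where "lead k A a" "a \<noteq> 0" by (rule lead_exists)
    with lead_mlinear[OF G G0, of k A a] that lead_unique[OF lead_0] show False by fastforce
  qed
  from this[of "_ - _"] have "A = B" if "G A = G B" for A B
    using that mlinear_simps(2)[OF G, of A B] by simp
  then have "inj G"
    by (rule injI)
  with mlinear_inj_imp_surj[OF G] show ?thesis by (simp add: bij_def)
qed

lemma unipotent_inv_lead:
  assumes G: "mlinear G" and G0: "\<And>a. lead 0 (G (mconst a)) a" and B: "lead k B b"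
  shows "lead k (inv G B) b"
proof -
  define A where "A = inv G B"
  have GA: "G A = B"
    unfolding A_def using unipotent_bij[OF G G0] by (simp add: bij_is_surj surj_f_inv_f)
  show ?thesis
  proof (cases "A = 0")
    case True
    then have "B = 0" using GA mlinear_simps(5)[OF G] by simp
    then have "b = 0" using B lead_unique[OF lead_0] by blast
    then show ?thesis using True by (simp add: A_def)
  next
    case False
    then obtain j a where a: "lead j A a" "a \<noteq> 0" by (rule lead_exists)
    with lead_mlinear[OF G G0, of j A a] have B': "lead j B a" by (simp add: GA)
    have "\<not> j < k"
      using lead_lower[OF B] lead_unique[OF B'] a(2) by blast
    then consider "j = k" | "k < j" by linarith
    then have "lead k A b"
    proof cases
      case 1
      then show ?thesis using a(1) lead_unique[OF B] B' by simp
    next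
      case 2
      then show ?thesis using lead_lower[OF a(1) 2] lead_unique[OF B lead_lower[OF B' 2]] by simp
    qed
    then show ?thesis by (simp add: A_def)
  qed
qed

lemma mlinear_inv:
  assumes G: "mlinear G" and "bij G"
  shows "mlinear (inv G)"
proof -
  have GI: "G (inv G A) = A" and IG: "inv G (G A) = A" for A
    using \<open>bij G\<close> by (simp_all add: bij_is_surj bij_is_inj surj_f_inv_f)
  show ?thesis
  proof (rule mlinearI)
    show "inv G (A + B) = inv G A + inv G B" for A B
      using IG[of "inv G A + inv G B"] by (simp add: mlinear_simps[OF G] GI)
    show "inv G (mscale c A) = mscale c (inv G A)" for c A
      using IG[of "mscale c (inv G A)"] by (simp add: mlinear_simps[OF G] GI)
  qed
qed

section \<open>Formal deformations\<close>

lemma mseries_mcoeff: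
  fixes A :: "'a::field fls^'n^'n"
  assumes "lead 0 A a"
  shows "A = mseries (\<lambda>i. mcoeff A (int i))"
proof -
  have "fls_nth (A $ i $ j) k = fls_nth (mseries (\<lambda>m. mcoeff A (int m)) $ i $ j) k" for i j k
    using assms by (simp add: mseries_def lead_iff_slead slead_def)
  then show ?thesis
    unfolding vec_eq_iff fls_eq_iff by blast
qed

lemma lead_mseries: "lead 0 (mseries f) (f 0)"
  by (simp add: lead_iff_slead slead_def mseries_def)

lemma mbilinear_mcoeff:
  assumes "mbilinear M"
  shows "mbilinear (\<lambda>a b. mcoeff (M (mconst a) (mconst b)) k)"
  by (rule mbilinearI; rule mlinearI) (simp_all add: mconst_simps mbilinear_simps[OF assms] mcoeff_simps)

text \<open>
  The coefficients \<open>\<mu>\<^sub>i\<close> of a multiplication are read off from its values on constant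
  matrices; bilinearity over \<open>K((t))\<close> makes them bilinear over \<open>K\<close>.
\<close>

lemma formal_deformation_withI:
  assumes "mbilinear M" "right_symmetric M" and M0: "\<And>a b. lead 0 (M (mconst a) (mconst b)) (a ** b)"
  shows "formal_deformation_with M (\<lambda>i a b. mcoeff (M (mconst a) (mconst b)) (int i))"
proof -
  have "mbilinear (\<lambda>a b. mcoeff (M (mconst a) (mconst b)) k)" for k
    by (rule mbilinear_mcoeff) fact
  moreover have "mcoeff (M (mconst a) (mconst b)) 0 = a ** b" for a b
    using M0 by (rule lead_mcoeff)
  ultimately show ?thesis
    using assms mseries_mcoeff[OF M0]
    by (simp add: formal_deformation_with_def has_expansion_def fun_eq_iff)
qed

lemma formal_deformationD:
  assumes "formal_deformation M"
  shows "mbilinear M" "right_symmetric M" "lead 0 (M (mconst a) (mconst b)) (a ** b)"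
proof -
  obtain \<mu> where \<mu>: "formal_deformation_with M \<mu>"
    using assms by (auto simp: formal_deformation_def)
  then show "mbilinear M" "right_symmetric M"
    by (auto simp: formal_deformation_with_def)
  have "M (mconst a) (mconst b) = mseries (\<lambda>i. \<mu> i a b)" "\<mu> 0 a b = a ** b"
    using \<mu> by (auto simp: formal_deformation_with_def has_expansion_def)
  then show "lead 0 (M (mconst a) (mconst b)) (a ** b)"
    using lead_mseries[of "\<lambda>i. \<mu> i a b"] by simp
qed

lemma deformation_equivI:
  assumes G: "mlinear G" and G0: "\<And>a. lead 0 (G (mconst a)) a"
    and hom: "\<And>a b. M (G (mconst a)) (G (mconst b)) = G (N (mconst a) (mconst b))"
  shows "deformation_equiv M N"
proof -
  define g where "g i a = mcoeff (G (mconst a)) (int i)" for i a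
  have "bij G" using G G0 by (rule unipotent_bij)
  moreover have "g 0 = id"
    using G0 by (auto simp: g_def lead_def fun_eq_iff)
  moreover have "mlinear (g i)" for i
    by (rule mlinearI) (simp_all add: g_def mconst_simps mlinear_simps[OF G] mcoeff_simps)
  moreover have "G (mconst a) = mseries (\<lambda>i. g i a)" for a
    unfolding g_def by (rule mseries_mcoeff[OF G0])
  ultimately show ?thesis
    unfolding deformation_equiv_def using G hom
    by (intro exI[of _ G] exI[of _ g]) (simp add: bij_is_inj)
qed

lemma mbilinear_eta_deformation: "mbilinear (eta_deformation X)"
  by (rule mbilinearI; rule mlinearI)
    (simp_all add: eta_deformation_def mbilinear_simps[OF mbilinear_eta] matrix_algebra mult.commute)

lemma trace_eta [simp]: "trace (eta X a b) = 0"
  by (simp add: eta_def)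

lemma mcomm_simps:
  fixes Z a b :: "'a::comm_ring_1^'n^'n"
  shows "mcomm Z (a + b) = mcomm Z a + mcomm Z b" "mcomm Z (mscale c a) = mscale c (mcomm Z a)"
    and "mcomm Z (a ** b) = mcomm Z a ** b + a ** mcomm Z b"
  by (simp_all add: mcomm_def matrix_algebra)

text \<open>
  The associator of \<open>m(a,b) = ab + t (tr b)[Z,a]\<close> is visibly symmetric in \<open>b\<close> and \<open>c\<close>. The
  formula rests on two facts: \<open>[Z,_]\<close> is a derivation, and commutators have trace zero. Since it
  is exact for every \<open>Z\<close>, there is no obstruction to integrating \<open>\<eta>\<^sub>Z\<close>.
\<close>

lemma eta_associator:
  fixes t :: "'a::field" and Z :: "'a^'n^'n"
  defines "m \<equiv> \<lambda>a b. a ** b + mscale t (eta Z a b)"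
  shows "m a (m b c) - m (m a b) c = mscale (t * trace (b ** c)) (mcomm Z a)
    - (mscale (t * trace c) (mcomm Z a ** b) + mscale (t * trace b) (mcomm Z a ** c))
    - mscale (t * trace b * (t * trace c)) (mcomm Z (mcomm Z a))"
  by (simp add: m_def eta_def trace_add mcomm_simps matrix_algebra mult_ac)

lemma right_symmetric_eta_deformation: "right_symmetric (eta_deformation X)"
  unfolding right_symmetric_def eta_deformation_def eta_associator
  by (simp add: trace_mult_commute mult_ac add.commute)

lemma slead_fls_X: "slead 1 fls_X 1"
  by (simp add: slead_def)

lemma lead_map_fps_to_fls: "lead 0 (map_matrix fps_to_fls X) (map_matrix (\<lambda>f. fps_nth f 0) X)"
  by (simp add: lead_iff_slead slead_def)

lemma lead_eta_deformation: "lead 0 (eta_deformation X (mconst a) (mconst b)) (a ** b)"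
proof -
  have "lead 1 (mscale fls_X (eta (map_matrix fps_to_fls X) (mconst a) (mconst b)))
    (mscale 1 (eta (map_matrix (\<lambda>f. fps_nth f 0) X) a b))"
    using lead_mscale[OF slead_fls_X lead_eta[OF lead_map_fps_to_fls lead_mconst lead_mconst]] by simp
  from lead_add[OF lead_mult[OF lead_mconst lead_mconst] lead_lower[OF this]] show ?thesis
    by (simp add: eta_deformation_def)
qed

lemma formal_deformation_eta: "formal_deformation (eta_deformation X)"
  unfolding formal_deformation_def
  using formal_deformation_withI mbilinear_eta_deformation right_symmetric_eta_deformation lead_eta_deformation
  by blast

section \<open>The leading error of an approximate equivalence\<close>

text \<open>
  Let \<open>D(a,b) = M(Ga,Gb) - G N(a,b)\<close> be the failure of \<open>G\<close> to be a homomorphism. Expanding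
  \<open>M\<close>-associators of elements in the image of \<open>G\<close> gives the exact identity
  \<open>D(a,N(b,c)) + M(Ga,D(b,c)) - D(N(a,b),c) - M(D(a,b),Gc) = A\<^sub>M(Ga,Gb,Gc) - G A\<^sub>N(a,b,c)\<close>,
  where \<open>A\<^sub>M\<close> and \<open>A\<^sub>N\<close> denote associators. The right-hand side is symmetric in \<open>b\<close> and
  \<open>c\<close>, and the lowest coefficient of the left-hand side is the Hochschild coboundary of \<open>R\<close>.
\<close>

lemma leading_error_is_cocycle:
  fixes M N :: "'a::field fls^'n^'n \<Rightarrow> 'a fls^'n^'n \<Rightarrow> 'a fls^'n^'n"
  assumes M: "formal_deformation M" and N: "formal_deformation N"
    and G: "mlinear G" and G0: "\<And>a. lead 0 (G (mconst a)) a"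
    and R: "\<And>a b. lead k (M (G (mconst a)) (G (mconst b)) - G (N (mconst a) (mconst b))) (R a b)"
  shows "local_deformation R"
proof -
  note M_simps = mbilinear_simps[OF formal_deformationD(1)[OF M]]
  note N_simps = mbilinear_simps[OF formal_deformationD(1)[OF N]]
  note G_simps = mlinear_simps[OF G]
  define D where "D A B = M (G A) (G B) - G (N A B)" for A B
  have D: "mbilinear D"
    by (rule mbilinearI; rule mlinearI) (simp_all add: D_def M_simps N_simps G_simps mscale_distribs)
  have R': "lead k (D (mconst a) (mconst b)) (R a b)" for a b
    unfolding D_def by (rule R)
  have lead_D: "lead (i + j + k) (D A B) (R a b)" if "lead i A a" "lead j B b" for i j A B a b
    by (rule lead_mbilinear[OF D R' that])
  have lead_M: "lead (i + j) (M A B) (a ** b)" if "lead i A a" "lead j B b" for i j A B a b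
    using lead_mbilinear[OF formal_deformationD(1)[OF M] formal_deformationD(3)[OF M] that] by simp
  have R_eq: "R = (\<lambda>a b. mcoeff (D (mconst a) (mconst b)) k)"
    using R' by (simp add: lead_def fun_eq_iff)
  have "mbilinear R"
    unfolding R_eq by (rule mbilinear_mcoeff[OF D])
  moreover have "a ** R b c - a ** R c b - R (a ** b) c + R (a ** c) b
        + R a (mcomm b c) - R a b ** c + R a c ** b = 0" for a b c
  proof -
    \<comment> \<open>\<open>E\<close> is the left-hand side of the identity; its leading coefficient is known, and
      \<open>E_eq\<close> makes its symmetry evident.\<close>
    define E where "E b c = D (mconst a) (N b c) + M (G (mconst a)) (D b c)
      - D (N (mconst a) b) c - M (D (mconst a) b) (G c)" for b c
    have lead_E: "lead k (E (mconst b) (mconst c)) (R a (b ** c) + a ** R b c - R (a ** b) c - R a b ** c)" for b c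
      unfolding E_def
      using lead_D[OF lead_mconst[of a] formal_deformationD(3)[OF N, of b c]]
        lead_M[OF G0[of a] R'[of b c]] lead_M[OF R'[of a b] G0[of c]]
        lead_D[OF formal_deformationD(3)[OF N, of a b] lead_mconst[of c]]
      by (intro lead_add lead_diff) simp_all
    have E_eq: "E b c = (M (G (mconst a)) (M (G b) (G c)) - M (M (G (mconst a)) (G b)) (G c))
        - G (N (mconst a) (N b c) - N (N (mconst a) b) c)" for b c
      by (simp add: E_def D_def M_simps G_simps)
    have "E (mconst b) (mconst c) = E (mconst c) (mconst b)"
      using formal_deformationD(2)[OF M] formal_deformationD(2)[OF N]
      unfolding E_eq right_symmetric_def by simp
    then have sym: "R a (b ** c) + a ** R b c - R (a ** b) c - R a b ** c
        = R a (c ** b) + a ** R c b - R (a ** c) b - R a c ** b"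
      using lead_E[of b c] lead_E[of c b] lead_unique by metis
    have "R a (mcomm b c) = R a (b ** c) - R a (c ** b)"
      by (simp add: mcomm_def mbilinear_simps[OF \<open>mbilinear R\<close>])
    then show ?thesis
      using sym by (simp only:) (simp add: algebra_simps)
  qed
  ultimately show ?thesis
    by (simp add: local_deformation_def)
qed

text \<open>
  The error of \<open>G\<close> as an equivalence between \<open>M\<close> and the normal form given by \<open>X\<close>.
\<close>

definition defect where
  "defect M G X a b = M (G (mconst a)) (G (mconst b)) - G (eta_deformation X (mconst a) (mconst b))"

text \<open>
  Changing \<open>G\<close> by \<open>t\<^sup>r \<omega>\<close> and \<open>X\<close> by \<open>t\<^bsup>r-1\<^esup> Y\<close> changes the coefficient of
  \<open>t\<^sup>r\<close> in the defect by \<open>d\<omega> - \<eta>\<^sub>Y\<close>. Up to sign every cocycle has this form, so any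
  cocycle that appears as leading error can be cancelled.
\<close>

lemma lead_defect_update:
  fixes M :: "'a::field fls^'n^'n \<Rightarrow> 'a fls^'n^'n \<Rightarrow> 'a fls^'n^'n"
  assumes M: "formal_deformation M" and "1 \<le> r"
    and G: "mlinear G" and G0: "\<And>a. lead 0 (G (mconst a)) a" and G': "mlinear G'"
    and \<omega>: "\<And>a. lead r (G' (mconst a) - G (mconst a)) (\<omega> a)"
    and Y: "lead (r - 1) (map_matrix fps_to_fls X' - map_matrix fps_to_fls X) Y"
  shows "lead r (defect M G' X' a b - defect M G X a b) (coboundary \<omega> a b - eta Y a b)"
proof -
  note M_simps = mbilinear_simps[OF formal_deformationD(1)[OF M]]
  define T where "T A = G' A - G A" for A
  define Z where "Z = map_matrix fps_to_fls X' - map_matrix fps_to_fls X"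
  have T: "mlinear T"
    unfolding T_def by (rule mlinear_diff[OF G' G])
  have T\<omega>: "lead r (T (mconst a)) (\<omega> a)" for a
    unfolding T_def by (rule \<omega>)
  have G'0: "lead 0 (G' (mconst a)) a" for a
    using lead_add[OF G0[of a] lead_lower[OF T\<omega>[of a], of 0]] \<open>1 \<le> r\<close> by (simp add: T_def)
  have lead_M: "lead (i + j) (M A B) (a ** b)" if "lead i A a" "lead j B b" for i j A B a b
    using lead_mbilinear[OF formal_deformationD(1)[OF M] formal_deformationD(3)[OF M] that] by simp
  have N': "eta_deformation X' A B = eta_deformation X A B + mscale fls_X (eta Z A B)" for A B
    by (simp add: eta_deformation_def Z_def eta_def mcomm_def matrix_algebra)
  have "defect M G' X' a b - defect M G X a b = M (G (mconst a)) (T (mconst b)) + M (T (mconst a)) (G (mconst b))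
    + M (T (mconst a)) (T (mconst b)) - T (eta_deformation X (mconst a) (mconst b))
    - G' (mscale fls_X (eta Z (mconst a) (mconst b)))"
    by (simp add: defect_def T_def N' M_simps mlinear_simps[OF G] mlinear_simps[OF G'])
  moreover have "lead r (M (G (mconst a)) (T (mconst b))) (a ** \<omega> b)"
    using lead_M[OF G0 T\<omega>] by simp
  moreover have "lead r (M (T (mconst a)) (G (mconst b))) (\<omega> a ** b)"
    using lead_M[OF T\<omega> G0] by simp
  moreover have "lead r (M (T (mconst a)) (T (mconst b))) 0"
    by (rule lead_lower[OF lead_M[OF T\<omega> T\<omega>]]) (use \<open>1 \<le> r\<close> in simp)
  moreover have "lead r (T (eta_deformation X (mconst a) (mconst b))) (\<omega> (a ** b))"
    using lead_mlinear[OF T T\<omega> lead_eta_deformation] by simp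
  moreover have "lead r (G' (mscale fls_X (eta Z (mconst a) (mconst b)))) (eta Y a b)"
    using lead_mlinear[OF G' G'0 lead_mscale[OF slead_fls_X lead_eta[OF Y lead_mconst lead_mconst]]]
    by (simp add: Z_def)
  ultimately have "lead r (defect M G' X' a b - defect M G X a b)
      (a ** \<omega> b + \<omega> a ** b + 0 - \<omega> (a ** b) - eta Y a b)"
    by (simp only: lead_add lead_diff)
  then show ?thesis
    by (simp add: coboundary_def algebra_simps)
qed

section \<open>Linear maps with prescribed coefficients\<close>

text \<open>
  The \<open>K((t))\<close>-linear extension of \<open>\<Sum> t\<^sup>i g\<^sub>i\<close>. It is defined through matrix units, so
  that it is a linear map even for families \<open>g\<close> that are not linear; this saves carrying linearity
  hypotheses through the recursion that constructs \<open>g\<close>.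
\<close>

definition lift :: "(nat \<Rightarrow> 'a::field^'n^'n \<Rightarrow> 'a^'n^'n) \<Rightarrow> 'a fls^'n^'n \<Rightarrow> 'a fls^'n^'n" where
  "lift g A = (\<Sum>p\<in>UNIV. \<Sum>q\<in>UNIV. mscale (A $ p $ q) (mseries (\<lambda>i. g i (munit p q))))"

lemma mlinear_lift: "mlinear (lift g)"
  by (rule mlinearI) (simp_all add: lift_def mscale_distribs sum.distrib mscale_sum)

lemma lead_lift_diff:
  assumes "\<And>s. s < r \<Longrightarrow> g' s = g s" and \<omega>: "mlinear \<omega>" and diff: "\<And>a. g' r a - g r a = \<omega> a"
  shows "lead (int r) (lift g' (mconst a) - lift g (mconst a)) (\<omega> a)"
proof -
  have L: "mlinear (\<lambda>A. lift g' A - lift g A)"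
    by (intro mlinear_diff mlinear_lift)
  have "lead (0 + int r) (\<Sum>p\<in>UNIV. \<Sum>q\<in>UNIV. mscale (mconst a $ p $ q) 
        (mseries (\<lambda>i. g' i (munit p q)) - mseries (\<lambda>i. g i (munit p q))))
      (\<Sum>p\<in>UNIV. \<Sum>q\<in>UNIV. mscale (a $ p $ q) (\<omega> (munit p q)))"
  proof (intro lead_sum lead_mscale)
    show "slead 0 (mconst a $ p $ q) (a $ p $ q)" for p q
      using lead_mconst[of a] by (simp add: lead_iff_slead)
    show "lead (int r) (mseries (\<lambda>i. g' i (munit p q)) - mseries (\<lambda>i. g i (munit p q))) (\<omega> (munit p q))" for p q
    proof -
      have "g' r (munit p q) $ i $ j - g r (munit p q) $ i $ j = \<omega> (munit p q) $ i $ j" for i j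
        by (simp flip: diff)
      then show ?thesis
        using assms(1) by (simp add: lead_iff_slead slead_def mseries_def nat_less_iff)
    qed
  qed
  then show ?thesis
    by (simp add: lift_def mscale_distribs sum_subtractf flip: mlinear_expand[OF \<omega>])
qed

lemma lift_id: "lift (\<lambda>i. if i = 0 then id else (\<lambda>_. 0)) A = A"
  for A :: "'a::field fls^'n^'n"
proof -
  have "mseries (\<lambda>i. (if i = 0 then id else (\<lambda>_. 0)) (munit p q :: 'a^'n^'n)) = (munit p q :: 'a fls^'n^'n)" for p q :: 'n
    by (auto simp: vec_eq_iff mseries_def fps_eq_iff)
  then show ?thesis
    by (simp add: lift_def flip: matrix_expand)
qed

lemma lead_lift: 
  assumes "g 0 = id"
  shows "lead 0 (lift g (mconst a)) a"
proof -
  have "lead (int 0) (lift g (mconst a) - lift (\<lambda>i. if i = 0 then id else (\<lambda>_. 0)) (mconst a)) 0"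
    by (rule lead_lift_diff) (simp_all add: assms mlinear_zero)
  then have "lead 0 (lift g (mconst a) - mconst a) 0"
    unfolding lift_id by simp
  from lead_add[OF this lead_mconst[of a]] show ?thesis by simp
qed

section \<open>Prolongation of local deformations\<close>

lemma eta_deformation_0: "eta_deformation 0 A B = A ** B"
  for A B :: "'a::field fls^'n^'n"
proof -
  have "map_matrix fps_to_fls 0 = (0 :: 'a fls^'n^'n)" by (simp add: vec_eq_iff)
  then show ?thesis by (simp add: eta_deformation_def eta_def mcomm_def)
qed

text \<open>
  If \<open>\<psi> = \<eta>\<^sub>X + d\<omega>\<close>, transport the deformation \<open>N(a,b) = ab + t (tr b)[X,a]\<close> along
  \<open>G = id + t \<omega>\<close>. The coefficient of \<open>t\<close> in \<open>G\<^bsup>-1\<^esup> N(Ga,Gb)\<close> is \<open>\<eta>\<^sub>X + d\<omega>\<close>;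
  it is computed by comparing the pair \<open>(G, 0)\<close> with \<open>(id, X)\<close>, whose defect vanishes.
\<close>

lemma local_deformation_prolongable:
  fixes \<psi> :: "'a::field_char_0^'n^'n \<Rightarrow> 'a^'n^'n \<Rightarrow> 'a^'n^'n"
  assumes "local_deformation \<psi>"
  shows "prolongable \<psi>"
proof -
  obtain X \<omega> where \<omega>: "mlinear \<omega>" and \<psi>: "\<And>a b. \<psi> a b - eta X a b = coboundary \<omega> a b"
    using cocycle_classification[OF assms] by (auto simp: cocycle_equiv_def)
  define N :: "'a fls^'n^'n \<Rightarrow> 'a fls^'n^'n \<Rightarrow> 'a fls^'n^'n" where "N = eta_deformation (map_matrix fps_const X)"
  define G where "G = lift (\<lambda>i. if i = 0 then id else if i = 1 then \<omega> else (\<lambda>_. 0))"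
  define W where "W A B = inv G (N (G A) (G B))" for A B
  have N: "formal_deformation N"
    unfolding N_def by (rule formal_deformation_eta)
  note N_simps = mbilinear_simps[OF formal_deformationD(1)[OF N]]
  have G: "mlinear G" and G0: "lead 0 (G (mconst a)) a" for a
    unfolding G_def by (rule mlinear_lift) (rule lead_lift, simp)
  have bij: "bij G"
    using G G0 by (rule unipotent_bij)
  have GI: "G (inv G A) = A" and IG: "inv G (G A) = A" for A
    using bij by (simp_all add: bij_is_surj bij_is_inj surj_f_inv_f)
  have I: "mlinear (inv G)"
    by (rule mlinear_inv[OF G bij])
  have W: "mbilinear W"
    by (rule mbilinearI; rule mlinearI)
      (simp_all add: W_def N_simps mlinear_simps[OF G] mlinear_simps[OF I])
  have "right_symmetric W"
    using formal_deformationD(2)[OF N]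
    by (simp add: right_symmetric_def W_def GI flip: mlinear_simps[OF I])
  moreover
  define E where "E a b = N (G (mconst a)) (G (mconst b)) - G (mconst (a ** b))" for a b
  have E: "lead 1 (E a b) (\<psi> a b)" for a b
  proof -
    have \<omega>': "lead 1 (G (mconst a) - mconst a) (\<omega> a)" for a
      using lead_lift_diff[of 1 "\<lambda>i. if i = 0 then id else if i = 1 then \<omega> else (\<lambda>_. 0)" 
          "\<lambda>i. if i = 0 then id else (\<lambda>_. 0)" \<omega> a] \<omega>
      by (simp add: G_def lift_id)
    have Y: "lead (1 - 1) (map_matrix fps_to_fls (0 :: 'a fps^'n^'n) - map_matrix fps_to_fls (map_matrix fps_const X)) (- X)"
      by (simp add: lead_iff_slead slead_def)
    have "lead 1 (defect N G 0 a b - defect N (\<lambda>x. x) (map_matrix fps_const X) a b) (coboundary \<omega> a b - eta (- X) a b)"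
      by (rule lead_defect_update[OF N _ mlinear_id lead_mconst G \<omega>' Y]) simp
    moreover have "defect N G 0 a b - defect N (\<lambda>x. x) (map_matrix fps_const X) a b = E a b"
      by (simp add: defect_def eta_deformation_0 N_def E_def mconst_simps)
    moreover have "coboundary \<omega> a b - eta (- X) a b = \<psi> a b"
      by (simp add: eta_def mcomm_def matrix_algebra flip: \<psi>)
    ultimately show ?thesis by simp
  qed
  have W_eq: "W (mconst a) (mconst b) = mconst (a ** b) + inv G (E a b)" for a b
    by (simp add: W_def E_def mlinear_simps[OF I] IG)
  have E': "lead 1 (inv G (E a b)) (\<psi> a b)" for a b
    by (rule unipotent_inv_lead[OF G G0 E])
  have "lead 0 (W (mconst a) (mconst b)) (a ** b)" for a b
    using lead_add[OF lead_mconst[of "a ** b"] lead_lower[OF E'[of a b], of 0]] by (simp add: W_eq)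
  ultimately have "formal_deformation_with W (\<lambda>i a b. mcoeff (W (mconst a) (mconst b)) (int i))"
    by (intro formal_deformation_withI W)
  moreover have "mcoeff (W (mconst a) (mconst b)) 1 = \<psi> a b" for a b
  proof -
    have "mcoeff (mconst (a ** b)) 1 = 0"
      by (simp add: vec_eq_iff mconst_def)
    then show ?thesis
      by (simp add: W_eq mcoeff_simps lead_mcoeff[OF E'])
  qed
  ultimately show ?thesis
    unfolding prolongable_def
    by (intro exI[of _ W] exI[of _ "\<lambda>i a b. mcoeff (W (mconst a) (mconst b)) (int i)"]) (simp add: fun_eq_iff)
qed

section \<open>A nontrivial deformation\<close>

text \<open>
  Equivalence with the matrix product would make the deformation associative. For
  \<open>X = e\<^sub>p\<^sub>p\<close> it is not: the associator of \<open>e\<^sub>p\<^sub>q, e\<^sub>p\<^sub>q, e\<^sub>q\<^sub>p\<close> is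
  \<open>t [X, e\<^sub>p\<^sub>q] = t e\<^sub>p\<^sub>q\<close>.
\<close>

lemma nontrivial_deformation_exists:
  assumes "2 \<le> CARD('n::finite)"
  shows "\<exists>M :: 'a::field fls^'n^'n \<Rightarrow> 'a fls^'n^'n \<Rightarrow> 'a fls^'n^'n. nontrivial_deformation M"
proof -
  obtain p q :: 'n where pq: "p \<noteq> q"
    using assms card_le_Suc0_iff_eq[of "UNIV :: 'n set"] by force
  define X :: "'a fps^'n^'n" where "X = munit p p"
  define M :: "'a fls^'n^'n \<Rightarrow> 'a fls^'n^'n \<Rightarrow> 'a fls^'n^'n" where "M = eta_deformation X"
  have M: "formal_deformation M"
    unfolding M_def by (rule formal_deformation_eta)
  note M_simps = mbilinear_simps[OF formal_deformationD(1)[OF M]]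
  have "\<not> deformation_equiv M (**)"
  proof
    assume "deformation_equiv M (**)"
    then obtain G where G: "mlinear G" "bij G"
      and eq: "\<And>a b. inv G (M (G (mconst a)) (G (mconst b))) = mconst a ** mconst b"
      unfolding deformation_equiv_def by blast
    have GI: "G (inv G A) = A" for A
      using G(2) by (simp add: bij_is_surj surj_f_inv_f)
    have hom: "M (G A) (G B) = G (A ** B)" for A B
    proof (rule mbilinear_eqI[where M = "\<lambda>A B. M (G A) (G B)" and N = "\<lambda>A B. G (A ** B)"])
      show "mbilinear (\<lambda>A B. M (G A) (G B))" "mbilinear (\<lambda>A B. G (A ** B))"
        by (rule mbilinearI; rule mlinearI; simp add: mlinear_simps[OF G(1)] M_simps matrix_algebra)+
      show "M (G (mconst a)) (G (mconst b)) = G (mconst a ** mconst b)" for a b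
        by (simp add: GI flip: eq)
    qed
    have assoc: "M A (M B C) = M (M A B) C" for A B C
      using hom[of "inv G A" "inv G B ** inv G C"] hom[of "inv G A ** inv G B" "inv G C"]
        hom[of "inv G A" "inv G B"] hom[of "inv G B" "inv G C"]
      by (simp add: GI matrix_mul_assoc)
    have X: "map_matrix fps_to_fls X = munit p p"
      by (simp add: X_def vec_eq_iff)
    have *: "M A B = A ** B + mscale (fls_X * trace B) (munit p p ** A - A ** munit p p)" for A B
      by (simp add: M_def eta_deformation_def X eta_def mcomm_def)
    have "M (munit p q) (M (munit p q) (munit q p)) = mscale fls_X (munit p q)"
      using pq by (simp add: * munit_mult trace_munit)
    moreover have "M (M (munit p q) (munit p q)) (munit q p) = 0"
      using pq by (simp add: * munit_mult trace_munit)
    ultimately have "mscale fls_X (munit p q) = (0 :: 'a fls^'n^'n)"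
      by (simp add: assoc)
    then have "mscale fls_X (munit p q) $ p $ q = (0 :: 'a fls)"
      by simp
    then show False by simp
  qed
  with M show ?thesis
    by (auto simp: nontrivial_deformation_def)
qed

section \<open>Normal form of formal deformations\<close>

text \<open>
  The equivalence \<open>G = id + t g\<^sub>1 + \<dots>\<close> and \<open>X = X\<^sub>0 + t X\<^sub>1 + \<dots>\<close> are found
  coefficient by coefficient. If the defect vanishes below \<open>t\<^bsup>r+1\<^esup>\<close>, its next coefficient is a
  cocycle, and by the classification of cocycles it is cancelled by a choice of \<open>g\<^bsub>r+1\<^esub>\<close> and
  \<open>X\<^sub>r\<close>. Later choices do not disturb the coefficients already dealt with, so dependent choice
  yields a pair whose defect is zero.
\<close>

lemma deformation_normal_form:
  fixes M :: "'a::field_char_0 fls^'n^'n \<Rightarrow> 'a fls^'n^'n \<Rightarrow> 'a fls^'n^'n"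
  assumes M: "formal_deformation M"
  shows "\<exists>X\<in>sl. deformation_equiv M (eta_deformation X)"
proof -
  \<comment> \<open>A sequence \<open>f\<close> stores \<open>(g\<^bsub>r+1\<^esub>, X\<^sub>r)\<close> at position \<open>r\<close>; the shift reflects the factor
    \<open>t\<close> in front of \<open>(tr b)[X,a]\<close> and keeps \<open>g\<^sub>0 = id\<close> out of the recursion.\<close>
  define G :: "(nat \<Rightarrow> ('a^'n^'n \<Rightarrow> 'a^'n^'n) \<times> ('a^'n^'n)) \<Rightarrow> 'a fls^'n^'n \<Rightarrow> 'a fls^'n^'n"
    where "G f = lift (case_nat id (\<lambda>r. fst (f r)))" for f
  define X :: "(nat \<Rightarrow> ('a^'n^'n \<Rightarrow> 'a^'n^'n) \<times> ('a^'n^'n)) \<Rightarrow> 'a fps^'n^'n"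
    where "X f = (\<chi> i j. Abs_fps (\<lambda>r. snd (f r) $ i $ j))" for f
  define P where "P f r x \<longleftrightarrow> snd x \<in> sl \<and>
    (\<forall>a b. mcoeff (defect M (G (f(r := x))) (X (f(r := x))) a b) (int r + 1) = 0)" for f r x
  have G: "mlinear (G f)" and G0: "lead 0 (G f (mconst a)) a" for f a
    unfolding G_def by (rule mlinear_lift) (rule lead_lift, simp)
  have defect0: "lead 0 (defect M (G f) (X f) a b) 0" for f a b
  proof -
    have "lead 0 (M (G f (mconst a)) (G f (mconst b))) (a ** b)"
      using lead_mbilinear[OF formal_deformationD(1)[OF M] formal_deformationD(3)[OF M] G0 G0] by simp
    moreover have "lead 0 (G f (eta_deformation (X f) (mconst a) (mconst b))) (a ** b)"
      using lead_mlinear[OF G G0 lead_eta_deformation] by simp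
    ultimately show ?thesis
      unfolding defect_def using lead_diff by fastforce
  qed
  have update: "lead (int r + 1) (defect M (G f') (X f') a b - defect M (G f) (X f) a b)
      (coboundary \<omega> a b - eta Y a b)"
    if below: "\<And>s. s < r \<Longrightarrow> f' s = f s" and \<omega>: "mlinear \<omega>" "\<And>a. fst (f' r) a - fst (f r) a = \<omega> a"
      and Y: "snd (f' r) - snd (f r) = Y" for f f' r \<omega> Y a b
  proof (rule lead_defect_update[OF M _ G G0 G])
    have "lead (int (Suc r)) (G f' (mconst a) - G f (mconst a)) (\<omega> a)" for a
      unfolding G_def by (rule lead_lift_diff) (use below \<omega> in \<open>auto split: nat.split\<close>)
    then show "lead (int r + 1) (G f' (mconst a) - G f (mconst a)) (\<omega> a)" for a
      by (simp add: add.commute)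
    have "snd (f' r) $ i $ j - snd (f r) $ i $ j = Y $ i $ j" for i j
      by (simp flip: Y)
    then show "lead (int r + 1 - 1) (map_matrix fps_to_fls (X f') - map_matrix fps_to_fls (X f)) Y"
      using below by (simp add: lead_iff_slead slead_def X_def nat_less_iff)
  qed simp
  \<comment> \<open>The coefficient of \<open>t\<^bsup>r+1\<^esup>\<close> in the defect depends on the first \<open>r + 1\<close> entries only.\<close>
  have local: "mcoeff (defect M (G f') (X f') a b) (int r + 1) = mcoeff (defect M (G f) (X f) a b) (int r + 1)"
    if "\<And>s. s \<le> r \<Longrightarrow> f' s = f s" for f f' r a b
  proof -
    have "lead (int r + 1) (defect M (G f') (X f') a b - defect M (G f) (X f) a b)
        (coboundary (\<lambda>_. 0) a b - eta 0 a b)"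
      by (rule update) (simp_all add: that mlinear_zero)
    then have "mcoeff (defect M (G f') (X f') a b - defect M (G f) (X f) a b) (int r + 1) = 0"
      by (simp add: lead_def coboundary_def eta_def mcomm_def)
    then show ?thesis
      by (simp add: vec_eq_iff)
  qed
  have "\<exists>f. \<forall>r. P f r (f r)"
  proof (rule dependent_wellorder_choice)
    show "P f r x = P g r x" if "\<And>s. s < r \<Longrightarrow> f s = g s" for f g r x
    proof -
      have "mcoeff (defect M (G (f(r := x))) (X (f(r := x))) a b) (int r + 1)
          = mcoeff (defect M (G (g(r := x))) (X (g(r := x))) a b) (int r + 1)" for a b
        by (rule local) (use that in auto)
      then show ?thesis by (simp add: P_def)
    qed
  next
    fix r f assume IH: "\<And>s. s < r \<Longrightarrow> P f s (f s)"
    \<comment> \<open>The entry of \<open>f\<close> at \<open>r\<close> is arbitrary, hence possibly not linear; it is reset before the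
      correction is added.\<close>
    define f0 where "f0 = f(r := (\<lambda>_. 0, 0))"
    define R where "R a b = mcoeff (defect M (G f0) (X f0) a b) (int r + 1)" for a b
    have R: "lead (int r + 1) (defect M (G f0) (X f0) a b) (R a b)" for a b
    proof -
      have "mcoeff (defect M (G f0) (X f0) a b) m = 0" if "m < int r + 1" for m
      proof (cases "m \<le> 0")
        case True
        then show ?thesis using defect0[of f0 a b] by (auto simp: lead_def le_less)
      next
        case False
        define s where "s = nat (m - 1)"
        have s: "m = int s + 1" "s < r" using False that by (auto simp: s_def)
        have "mcoeff (defect M (G f0) (X f0) a b) (int s + 1) = mcoeff (defect M (G f) (X f) a b) (int s + 1)"
          by (rule local) (use s(2) in \<open>auto simp: f0_def\<close>)
        also have "\<dots> = 0"
          using IH[OF s(2)] by (simp add: P_def)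
        finally show ?thesis by (simp add: s)
      qed
      then show ?thesis by (simp add: lead_def R_def)
    qed
    have "local_deformation R"
      by (rule leading_error_is_cocycle[OF M formal_deformation_eta G G0 R[unfolded defect_def]])
    then obtain Y \<omega> where Y: "Y \<in> sl" and \<omega>: "mlinear \<omega>" and R_eq: "\<And>a b. R a b - eta Y a b = coboundary \<omega> a b"
      using cocycle_classification by (metis cocycle_equiv_def)
    define f1 where "f1 = f(r := (\<lambda>a. - \<omega> a, Y))"
    have step: "lead (int r + 1) (defect M (G f1) (X f1) a b - defect M (G f0) (X f0) a b)
        (coboundary (\<lambda>a. - \<omega> a) a b - eta Y a b)" for a b
      by (rule update) (simp_all add: f0_def f1_def mlinear_uminus \<omega>)
    have cancel: "coboundary (\<lambda>a. - \<omega> a) a b - eta Y a b = - R a b" for a b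
      using R_eq[of a b] by (simp add: coboundary_def matrix_algebra algebra_simps)
    have "lead (int r + 1) (defect M (G f1) (X f1) a b) 0" for a b
      using lead_add[OF step[of a b, unfolded cancel] R[of a b]] by simp
    then have "P f r (\<lambda>a. - \<omega> a, Y)"
      using Y by (simp add: P_def lead_def f1_def)
    then show "\<exists>x. P f r x" ..
  qed
  then obtain f where f: "\<And>r. P f r (f r)" by blast
  have "defect M (G f) (X f) a b = 0" for a b
  proof (rule mcoeff_eq_0_imp)
    fix k
    show "mcoeff (defect M (G f) (X f) a b) k = 0"
    proof (cases "k \<le> 0")
      case True
      then show ?thesis using defect0[of f a b] by (auto simp: lead_def le_less)
    next
      case False
      then have "k = int (nat (k - 1)) + 1" by simp
      then show ?thesis using f[of "nat (k - 1)"] unfolding P_def by (metis fun_upd_triv)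
    qed
  qed
  then have "deformation_equiv M (eta_deformation (X f))"
    by (intro deformation_equivI[OF G[of f] G0]) (simp add: defect_def)
  moreover have "X f \<in> sl"
  proof -
    have "trace (snd (f r)) = 0" for r
      using f[of r] by (simp add: P_def sl_def)
    then show ?thesis
      by (simp add: sl_def X_def trace_def fps_eq_iff fps_sum_nth)
  qed
  ultimately show ?thesis by blast
qed

theorem corollary5p12:
  shows "(2 \<le> CARD('n::finite) \<longrightarrow>
            (\<exists>M :: 'k::field_char_0 fls^'n^'n \<Rightarrow> 'k fls^'n^'n \<Rightarrow> 'k fls^'n^'n.
               nontrivial_deformation M))
    \<and> (\<forall>\<psi> :: 'k^'n^'n \<Rightarrow> 'k^'n^'n \<Rightarrow> 'k^'n^'n. local_deformation \<psi> \<longrightarrow>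
         (\<exists>X\<in>sl. local_deformation (eta X) \<and> cocycle_equiv \<psi> (eta X)))
    \<and> (\<forall>\<psi> :: 'k^'n^'n \<Rightarrow> 'k^'n^'n \<Rightarrow> 'k^'n^'n. local_deformation \<psi> \<longrightarrow> prolongable \<psi>)
    \<and> (\<forall>M :: 'k fls^'n^'n \<Rightarrow> 'k fls^'n^'n \<Rightarrow> 'k fls^'n^'n. formal_deformation M \<longrightarrow>
         (\<exists>X\<in>sl. formal_deformation (eta_deformation X)
                \<and> deformation_equiv M (eta_deformation X)))"
proof (intro conjI allI impI)
  fix \<psi> :: "'k^'n^'n \<Rightarrow> 'k^'n^'n \<Rightarrow> 'k^'n^'n"
  assume "local_deformation \<psi>"
  then show "\<exists>X\<in>sl. local_deformation (eta X) \<and> cocycle_equiv \<psi> (eta X)"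
    using cocycle_classification local_deformation_eta by blast
next
  fix M :: "'k fls^'n^'n \<Rightarrow> 'k fls^'n^'n \<Rightarrow> 'k fls^'n^'n"
  assume "formal_deformation M"
  then show "\<exists>X\<in>sl. formal_deformation (eta_deformation X) \<and> deformation_equiv M (eta_deformation X)"
    using deformation_normal_form formal_deformation_eta by blast
qed (fact nontrivial_deformation_exists local_deformation_prolongable)+

end
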